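(* Let $f_1,f_2:\mathbb R^+\to\mathbb R^+$ be continuous and strictly increasing with $f_i(x)>0$ for $x>0$, $i=1,2$. Let $h_i:\mathbb R^+\to\mathbb R$ ($i=1,2$) be Lebesgue measurable with $h_i(t)\le t$ and $\lim_{t\to\infty}h_i(t)=\infty$. For $i=1,2$ let $R_i(t,\cdot)$ be left continuous and non-decreasing for any $t$, let $R_i(\cdot,s)$ be locally integrable for any $s$, let $R_i(t,s)=0$ for $s\le h_i(t)$ and $R_i(t,t^+)=1$, and let $r_i$ be a Lebesgue measurable essentially bounded function on $\mathbb R^+$ with $r_i(t)\ge 0$ and $\int_0^\infty r_i(s)\,ds=\infty$. Let $\varphi,\psi:(-\infty,0]\to\mathbb R$ be continuous bounded functions with $\varphi(t)\ge 0$, $\psi(t)\ge 0$ for $t<0$ and $\varphi(0)>0$, $\psi(0)>0$. Consider the initial value problem (P) described in the context. 1) If $f_2(x)<f_1^{-1}(x)$ for any $x>0$, then every solution of (P) converges to zero (both components) as $t\to\infty$. 2) If $f_2(x)>f_1^{-1}(x)$ for any $x>0$, then every global solution of (P) (i.e. solution defined on $[0,\infty)$) tends to $+\infty$ (both components) as $t\to\infty$.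
   Context: $\mathbb R^+=[0,\infty)$; $u(t^+)$ is the right-side limit of $u$ at $t$. Problem (P) is the system $$x'(t)=r_1(t)\left[\int_{h_1(t)}^t f_1(y(s))\,d_sR_1(t,s)-x(t)\right],\quad y'(t)=r_2(t)\left[\int_{h_2(t)}^t f_2(x(s))\,d_sR_2(t,s)-y(t)\right]$$ with the initial conditions $x(t)=\varphi(t)$, $y(t)=\psi(t)$ for $t\le 0$. The integrals are Stieltjes integrals in $s$ over $[h_i(t),t]$ including the endpoint atoms, i.e. with respect to the probability measure on $[h_i(t),t]$ with (left continuous) distribution function $R_i(t,\cdot)$. A solution is a pair $(x,y)$, locally absolutely continuous on $[0,\infty)$, which satisfies the system for almost all $t\ge0$ and the initial conditions for $t\le0$. Convention: $f_1^{-1}$ is the inverse of $f_1$ on its range, $f_1^{-1}(x)=0$ for $0\le x<f_1(0)$, and $f_1^{-1}(x)=+\infty$ for $x$ above the range of $f_1$. *)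

theory Defs
  imports "HOL-Analysis.Analysis"
begin

text \<open>
  The inverse of a strictly increasing \<open>f\<close> on \<open>[0, \<infinity>)\<close>, extended by \<open>0\<close> below its range and
  by \<open>+\<infinity>\<close> above it. For continuous \<open>f\<close> the range is an interval with minimum \<open>f 0\<close>, so the
  last case consists exactly of the points above the range.
\<close>
definition ext_inv :: "(real \<Rightarrow> real) \<Rightarrow> real \<Rightarrow> ereal" where
  "ext_inv f x =
     (if x < f 0 then 0
      else if x \<in> f ` {0..} then ereal (the_inv_into {0..} f x)
      else \<infinity>)"

definition abs_cont_on_Icc :: "real \<Rightarrow> real \<Rightarrow> (real \<Rightarrow> real) \<Rightarrow> bool" where
  "abs_cont_on_Icc a b f \<longleftrightarrow>
     (\<forall>\<epsilon>>0. \<exists>\<delta>>0. \<forall>D :: (real \<times> real) set.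
        finite D \<longrightarrow>
        (\<forall>(c, d)\<in>D. a \<le> c \<and> c \<le> d \<and> d \<le> b) \<longrightarrow>
        pairwise (\<lambda>(c, d) (c', d'). {c<..<d} \<inter> {c'<..<d'} = {}) D \<longrightarrow>
        (\<Sum>(c, d)\<in>D. d - c) < \<delta> \<longrightarrow>
        (\<Sum>(c, d)\<in>D. \<bar>f d - f c\<bar>) < \<epsilon>)"

definition loc_abs_cont_nonneg :: "(real \<Rightarrow> real) \<Rightarrow> bool" where
  "loc_abs_cont_nonneg f \<longleftrightarrow> (\<forall>T>0. abs_cont_on_Icc 0 T f)"

text \<open>
  The Stieltjes measure of a non-decreasing, left continuous \<open>G\<close>, that is, the measure giving
  \<open>{a..<b}\<close> the mass \<open>G b - G a\<close>. Since \<^const>\<open>interval_measure\<close> expects a right continuous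
  function, \<open>G\<close> is replaced by its right-limit function \<open>s \<mapsto> G(s\<^sup>+)\<close>, which induces the same measure.
\<close>
definition left_stieltjes_measure :: "(real \<Rightarrow> real) \<Rightarrow> real measure" where
  "left_stieltjes_measure G = interval_measure (\<lambda>s. Lim (at_right s) G)"

text \<open>
  The integral of \<open>g(s) d\<^sub>sR(t,s)\<close> over the closed interval from \<open>h(t)\<close> to \<open>t\<close>; atoms at both
  endpoints count. If \<open>R(t,s) = 0\<close> for \<open>s \<le> h(t)\<close> and \<open>R(t,t\<^sup>+) = 1\<close>, the measure restricted to
  this interval is a probability measure.
\<close>
definition delay_integral ::
  "(real \<Rightarrow> real) \<Rightarrow> (real \<Rightarrow> real \<Rightarrow> real) \<Rightarrow> (real \<Rightarrow> real) \<Rightarrow> real \<Rightarrow> real" where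
  "delay_integral h R g t = (LINT s:{h t..t}|left_stieltjes_measure (R t). g s)"

text \<open>
  Solutions on \<open>[0, \<infinity>)\<close>. Nonnegativity is not required: for the data considered, both components
  remain positive on \<open>[0, \<infinity>)\<close>, so values of \<open>f1\<close>, \<open>f2\<close> at negative arguments never matter.
\<close>
definition is_solution ::
  "(real \<Rightarrow> real) \<Rightarrow> (real \<Rightarrow> real) \<Rightarrow> (real \<Rightarrow> real) \<Rightarrow> (real \<Rightarrow> real) \<Rightarrow>
   (real \<Rightarrow> real \<Rightarrow> real) \<Rightarrow> (real \<Rightarrow> real \<Rightarrow> real) \<Rightarrow> (real \<Rightarrow> real) \<Rightarrow> (real \<Rightarrow> real) \<Rightarrow>
   (real \<Rightarrow> real) \<Rightarrow> (real \<Rightarrow> real) \<Rightarrow> (real \<Rightarrow> real) \<Rightarrow> (real \<Rightarrow> real) \<Rightarrow> bool" where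
  "is_solution f1 f2 h1 h2 R1 R2 r1 r2 \<phi> \<psi> x y \<longleftrightarrow>
     loc_abs_cont_nonneg x \<and> loc_abs_cont_nonneg y \<and>
     (\<forall>t\<le>0. x t = \<phi> t \<and> y t = \<psi> t) \<and>
     (AE t in lebesgue. t \<ge> 0 \<longrightarrow>
        (x has_real_derivative
           r1 t * (delay_integral h1 R1 (\<lambda>s. f1 (y s)) t - x t)) (at t) \<and>
        (y has_real_derivative
           r2 t * (delay_integral h2 R2 (\<lambda>s. f2 (x s)) t - y t)) (at t))"

definition admissible_nonlinearity :: "(real \<Rightarrow> real) \<Rightarrow> bool" where
  "admissible_nonlinearity f \<longleftrightarrow>
     f \<in> {0..} \<rightarrow> {0..} \<and> continuous_on {0..} f \<and> strict_mono_on {0..} f \<and> (\<forall>z>0. f z > 0)"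

definition admissible_delay :: "(real \<Rightarrow> real) \<Rightarrow> bool" where
  "admissible_delay h \<longleftrightarrow>
     h \<in> borel_measurable (lebesgue_on {0..}) \<and> (\<forall>t\<ge>0. h t \<le> t) \<and> filterlim h at_top at_top"

definition admissible_kernel :: "(real \<Rightarrow> real) \<Rightarrow> (real \<Rightarrow> real \<Rightarrow> real) \<Rightarrow> bool" where
  "admissible_kernel h R \<longleftrightarrow>
     (\<forall>t\<ge>0. (\<forall>s. continuous (at_left s) (R t)) \<and> mono (R t)) \<and>
     (\<forall>s. \<forall>T>0. (\<lambda>t. R t s) absolutely_integrable_on {0..T}) \<and>
     (\<forall>t\<ge>0. \<forall>s\<le>h t. R t s = 0) \<and>
     (\<forall>t\<ge>0. (R t \<longlongrightarrow> 1) (at_right t))"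

definition admissible_rate :: "(real \<Rightarrow> real) \<Rightarrow> bool" where
  "admissible_rate r \<longleftrightarrow>
     r \<in> borel_measurable (lebesgue_on {0..}) \<and>
     (\<exists>C. AE t in lebesgue_on {0..}. \<bar>r t\<bar> \<le> C) \<and>
     (\<forall>t\<ge>0. r t \<ge> 0) \<and>
     (\<integral>\<^sup>+ t. ennreal (r t) \<partial>lebesgue_on {0..}) = \<infinity>"

definition admissible_history :: "(real \<Rightarrow> real) \<Rightarrow> bool" where
  "admissible_history \<phi> \<longleftrightarrow>
     continuous_on {..0} \<phi> \<and> bounded (\<phi> ` {..0}) \<and> (\<forall>t<0. \<phi> t \<ge> 0) \<and> \<phi> 0 > 0"

end

theory Submission
  imports Defs
begin

text \<open>
  The integral term is an average of past values of \<open>f(y)\<close>, so bounds \<open>l \<le> y \<le> u\<close> on the past push \<open>x\<close>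
  towards \<open>[f l, f u]\<close>, and since the rate has infinite integral, \<open>x\<close> eventually comes arbitrarily
  close to this interval. Going around the loop once, an eventual upper bound \<open>c\<close> of \<open>x\<close> improves to
  every number above \<open>f1 (f2 c)\<close>, and likewise for lower bounds. The hypotheses on \<open>f2\<close> and the inverse
  of \<open>f1\<close> say that \<open>f1 (f2 z) < z\<close>, respectively \<open>f1 (f2 z) > z\<close>, for all \<open>z > 0\<close>; hence the infimum of
  the eventual upper bounds is \<open>0\<close>, respectively the eventual positive lower bounds are unbounded.
  A first finite upper (positive lower) bound comes from an invariant rectangle.
\<close>

subsection \<open>Absolutely continuous functions\<close>

lemma abs_cont_on_Icc_subset:
  assumes "abs_cont_on_Icc a b f" "a \<le> a'" "b' \<le> b"
  shows "abs_cont_on_Icc a' b' f"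
  unfolding abs_cont_on_Icc_def
proof (intro allI impI)
  fix \<epsilon> :: real assume "\<epsilon> > 0"
  then obtain \<delta> where "\<delta> > 0" and \<delta>: "\<And>D :: (real \<times> real) set. finite D \<Longrightarrow> (\<forall>(c, d)\<in>D. a \<le> c \<and> c \<le> d \<and> d \<le> b) \<Longrightarrow>
        pairwise (\<lambda>(c, d) (c', d'). {c<..<d} \<inter> {c'<..<d'} = {}) D \<Longrightarrow>
        (\<Sum>(c, d)\<in>D. d - c) < \<delta> \<Longrightarrow> (\<Sum>(c, d)\<in>D. \<bar>f d - f c\<bar>) < \<epsilon>"
    using assms(1) unfolding abs_cont_on_Icc_def by meson
  show "\<exists>\<delta>>0. \<forall>D. finite D \<longrightarrow> (\<forall>(c, d)\<in>D. a' \<le> c \<and> c \<le> d \<and> d \<le> b') \<longrightarrow>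
        pairwise (\<lambda>(c, d) (c', d'). {c<..<d} \<inter> {c'<..<d'} = {}) D \<longrightarrow>
        (\<Sum>(c, d)\<in>D. d - c) < \<delta> \<longrightarrow> (\<Sum>(c, d)\<in>D. \<bar>f d - f c\<bar>) < \<epsilon>"
    using \<open>\<delta> > 0\<close> assms(2,3) by (intro exI[of _ \<delta>] conjI allI impI \<delta>) fastforce+
qed

lemma loc_abs_cont_nonneg_imp_Icc:
  assumes "loc_abs_cont_nonneg f" "0 \<le> a"
  shows "abs_cont_on_Icc a b f"
proof -
  have "abs_cont_on_Icc 0 (max b 1) f"
    using assms(1) unfolding loc_abs_cont_nonneg_def by (simp add: max.strict_coboundedI2)
  then show ?thesis
    by (rule abs_cont_on_Icc_subset) (use assms(2) in auto)
qed

lemma abs_cont_on_Icc_minus: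
  assumes "abs_cont_on_Icc a b f"
  shows "abs_cont_on_Icc a b (\<lambda>t. - f t)"
proof -
  have "\<bar>- f d - - f c\<bar> = \<bar>f d - f c\<bar>" for c d
    by simp
  then show ?thesis
    using assms unfolding abs_cont_on_Icc_def by simp
qed

lemma abs_cont_on_Icc_imp_continuous_on:
  assumes "abs_cont_on_Icc a b f"
  shows "continuous_on {a..b} f"
  unfolding continuous_on_iff
proof (intro ballI allI impI)
  fix t \<epsilon> :: real assume t: "t \<in> {a..b}" and "\<epsilon> > 0"
  then obtain \<delta> where "\<delta> > 0" and \<delta>: "\<And>D :: (real \<times> real) set. finite D \<Longrightarrow> (\<forall>(c, d)\<in>D. a \<le> c \<and> c \<le> d \<and> d \<le> b) \<Longrightarrow>
        pairwise (\<lambda>(c, d) (c', d'). {c<..<d} \<inter> {c'<..<d'} = {}) D \<Longrightarrow>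
        (\<Sum>(c, d)\<in>D. d - c) < \<delta> \<Longrightarrow> (\<Sum>(c, d)\<in>D. \<bar>f d - f c\<bar>) < \<epsilon>"
    using assms unfolding abs_cont_on_Icc_def by meson
  show "\<exists>\<delta>>0. \<forall>s\<in>{a..b}. dist s t < \<delta> \<longrightarrow> dist (f s) (f t) < \<epsilon>"
  proof (intro exI[of _ \<delta>] conjI ballI impI)
    fix s assume "s \<in> {a..b}" "dist s t < \<delta>"
    then show "dist (f s) (f t) < \<epsilon>"
      using \<delta>[of "{(min s t, max s t)}"] t
      by (cases "s \<le> t") (auto simp: dist_real_def min_def max_def abs_minus_commute split: if_splits)
  qed (fact \<open>\<delta> > 0\<close>)
qed

text \<open>
  The gauge sends points of the null set \<open>N\<close> into an open set of small measure, where absolute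
  continuity bounds the increments of \<open>f\<close>; elsewhere it comes from differentiability.
\<close>

lemma abs_cont_has_integral:
  fixes f f' :: "real \<Rightarrow> real"
  assumes "a \<le> b" and ac: "abs_cont_on_Icc a b f" and N: "negligible N"
    and der: "\<And>t. t \<in> {a..b} - N \<Longrightarrow> (f has_real_derivative f' t) (at t)"
  shows "(f' has_integral (f b - f a)) {a..b}"
proof (cases "a = b")
  case True
  then show ?thesis
    by (auto intro: has_integral_null_real)
next
  case False
  then have "a < b"
    using \<open>a \<le> b\<close> by simp
  \<comment> \<open>The value 0 on \<open>N\<close> makes the error of an interval tagged in
    \<open>N\<close> equal to an increment of \<open>f\<close>. The allowed error
    \<open>e * (b - a)\<close> is shared equally between tags in \<open>N\<close> and tags
    outside.\<close>
  define g where "g t = (if t \<in> N then 0 else f' t)" for t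
  have "(g has_integral (f b - f a)) {a..b}"
    unfolding has_integral_factor_content_real
  proof (intro allI impI)
    fix e :: real assume "e > 0"
    then have e': "e / 2 * (b - a) > 0" "e / 2 > 0"
      using \<open>a < b\<close> by auto
    obtain \<delta> where "\<delta> > 0" and \<delta>: "\<And>D :: (real \<times> real) set. finite D \<Longrightarrow> (\<forall>(c, d)\<in>D. a \<le> c \<and> c \<le> d \<and> d \<le> b) \<Longrightarrow>
        pairwise (\<lambda>(c, d) (c', d'). {c<..<d} \<inter> {c'<..<d'} = {}) D \<Longrightarrow>
        (\<Sum>(c, d)\<in>D. d - c) < \<delta> \<Longrightarrow> (\<Sum>(c, d)\<in>D. \<bar>f d - f c\<bar>) < e / 2 * (b - a)"
      using ac e'(1) unfolding abs_cont_on_Icc_def by meson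
    have Nnull: "N \<in> null_sets lebesgue"
      using N by (simp add: negligible_iff_null_sets)
    then obtain U where U: "open U" "N \<subseteq> U" "U - N \<in> lmeasurable" "emeasure lebesgue (U - N) < ennreal \<delta>"
      using sets_lebesgue_outer_open[of N \<delta>] \<open>\<delta> > 0\<close> by blast
    have "emeasure lebesgue U = emeasure lebesgue (U - N)"
      by (rule emeasure_Diff_null_set[symmetric]) (use Nnull U(1) in auto)
    then have Usmall: "emeasure lebesgue U < ennreal \<delta>" "U \<in> lmeasurable"
      using U by (auto simp: fmeasurable_def order.strict_trans)
    then have mU: "measure lebesgue U < \<delta>"
      by (metis \<open>\<delta> > 0\<close> emeasure_eq_measure2 ennreal_less_iff measure_nonneg)
    have "\<exists>d>0. \<forall>s. \<bar>s - t\<bar> < d \<longrightarrow> \<bar>f s - f t - f' t * (s - t)\<bar> \<le> e / 2 * \<bar>s - t\<bar>" if "t \<in> {a..b} - N" for t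
    proof -
      have "\<forall>e>0. \<exists>d>0. \<forall>s. \<bar>s - t\<bar> < d \<longrightarrow> \<bar>f s - f t - f' t * (s - t)\<bar> \<le> e * \<bar>s - t\<bar>"
        using der[OF that] unfolding has_field_derivative_def has_derivative_at_alt by simp
      then show ?thesis
        using e'(2) by blast
    qed
    then obtain d where d: "\<And>t. t \<in> {a..b} - N \<Longrightarrow> d t > 0"
      "\<And>t s. t \<in> {a..b} - N \<Longrightarrow> \<bar>s - t\<bar> < d t \<Longrightarrow> \<bar>f s - f t - f' t * (s - t)\<bar> \<le> e / 2 * \<bar>s - t\<bar>"
      by metis
    define \<gamma> where "\<gamma> t = (if t \<in> N then U else if t \<in> {a..b} then ball t (d t) else UNIV)" for t
    show "\<exists>\<gamma>. gauge \<gamma> \<and> (\<forall>p. p tagged_division_of {a..b} \<and> \<gamma> fine p \<longrightarrow>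
             norm ((\<Sum>(x, K)\<in>p. measure lborel K *\<^sub>R g x) - (f b - f a)) \<le> e * measure lborel {a..b})"
    proof (intro exI[of _ \<gamma>] conjI allI impI; (elim conjE)?)
      show "gauge \<gamma>"
        using U d(1) unfolding gauge_def \<gamma>_def by auto
    next
      fix p assume p: "p tagged_division_of {a..b}" and fine: "\<gamma> fine p"
      have "finite p"
        using p by blast
      have box: "K = {Inf K..Sup K} \<and> Inf K \<le> x \<and> x \<le> Sup K \<and> a \<le> Inf K \<and> Sup K \<le> b \<and> K \<subseteq> \<gamma> x"
        if xK: "(x, K) \<in> p" for x K
      proof -
        obtain u v where uv: "K = {u..v}"
          using tagged_division_ofD(4)[OF p xK] by auto
        moreover have "x \<in> K" "K \<subseteq> {a..b}"
          using tagged_division_ofD(2,3)[OF p that] by auto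
        moreover have "K \<subseteq> \<gamma> x"
          using fine that unfolding fine_def by auto
        ultimately show ?thesis
          by auto
      qed
      have ends: "Inf K \<le> Sup K" "a \<le> Inf K" "Sup K \<le> b" if "(x, K) \<in> p" for x K
        using box[OF that] by linarith+
      define q where "q = {(x, K) \<in> p. x \<in> N}"
      define E where "E = (\<lambda>(x, K). measure lborel K * g x - (f (Sup K) - f (Inf K)))"
      have "q \<subseteq> p" "finite q"
        using \<open>finite p\<close> by (auto simp: q_def intro: finite_subset)
      have total: "(\<Sum>(x, k)\<in>p. measure lborel k *\<^sub>R g x) - (f b - f a) = sum E p"
        using additive_tagged_division_1[OF \<open>a \<le> b\<close> p, of f]
        by (simp add: E_def sum_subtractf case_prod_unfold)
      define \<iota> where "\<iota> = (\<lambda>(x :: real, K :: real set). (Inf K, Sup K))"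
      have disj: "{Inf K<..<Sup K} \<inter> {Inf K'<..<Sup K'} = {}"
        if "(x, K) \<in> p" "(x', K') \<in> p" "(x, K) \<noteq> (x', K')" for x K x' K'
      proof -
        have "interior K \<inter> interior K' = {}"
          using tagged_division_ofD(5)[OF p that] .
        then show ?thesis
          using box[OF that(1)] box[OF that(2)] by (metis interior_atLeastAtMost_real)
      qed
      have pw: "pairwise (\<lambda>(c, d) (c', d'). {c<..<d} \<inter> {c'<..<d'} = {}) (\<iota> ` q)"
        unfolding pairwise_def \<iota>_def using disj \<open>q \<subseteq> p\<close> by fastforce
      have "(\<Sum>(c, d)\<in>\<iota> ` q. d - c) = (\<Sum>I\<in>\<iota> ` q. measure lebesgue (case I of (c, d) \<Rightarrow> {c<..<d}))"
        by (rule sum.cong) (auto simp: \<iota>_def q_def dest: ends(1))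
      also have "\<dots> = measure lebesgue (\<Union>I\<in>\<iota> ` q. case I of (c, d) \<Rightarrow> {c<..<d})"
      proof (rule measure_finite_Union[symmetric])
        show "disjoint_family_on (case_prod greaterThanLessThan) (\<iota> ` q)"
          using pw unfolding disjoint_family_on_def pairwise_def by (auto simp: case_prod_unfold)
        show "emeasure lebesgue (case I of (c, d) \<Rightarrow> {c<..<d}) \<noteq> \<infinity>" for I :: "real \<times> real"
          using emeasure_lborel_box_finite[of "fst I" "snd I"] by (auto simp: case_prod_unfold)
      qed (use \<open>finite q\<close> in auto)
      also have "\<dots> \<le> measure lebesgue U"
      proof (rule measure_mono_fmeasurable)
        show "(\<Union>I\<in>\<iota> ` q. case I of (c, d) \<Rightarrow> {c<..<d}) \<subseteq> U"
        proof -
          have "{Inf K<..<Sup K} \<subseteq> U" if "(x, K) \<in> p" "x \<in> N" for x K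
          proof -
            have "{Inf K..Sup K} \<subseteq> U"
              using box[OF that(1)] that(2) by (auto simp: \<gamma>_def)
            then show ?thesis
              using greaterThanLessThan_subseteq_atLeastAtMost_iff by fastforce
          qed
          then show ?thesis
            by (fastforce simp: \<iota>_def q_def)
        qed
      qed (use Usmall \<open>finite q\<close> in \<open>auto simp: case_prod_unfold intro!: sets.finite_UN\<close>)
      finally have small: "(\<Sum>(c, d)\<in>\<iota> ` q. d - c) < \<delta>"
        using mU by simp
      \<comment> \<open>Injectivity of \<open>\<iota>\<close> is avoided: distinct members of
        \<open>q\<close> with equal endpoints have disjoint interiors, hence are degenerate, and a
        degenerate interval contributes 0 to the reindexed sum.\<close>
      have degen: "(\<lambda>(c, d). \<bar>f d - f c\<bar>) (\<iota> i) = 0"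
        if "i \<in> q" "j \<in> q" "i \<noteq> j" "\<iota> i = \<iota> j" for i j
      proof -
        obtain x K x' K' where ij: "i = (x, K)" "j = (x', K')"
          by (metis surj_pair)
        have "{Inf K<..<Sup K} = {}"
          using disj[of x K x' K'] that \<open>q \<subseteq> p\<close> by (auto simp: \<iota>_def ij)
        moreover have "Inf K \<le> Sup K"
          using ends[of x K] that(1) \<open>q \<subseteq> p\<close> by (auto simp: ij)
        ultimately show ?thesis
          by (simp add: ij \<iota>_def)
      qed
      have "(\<Sum>I\<in>\<iota> ` q. case I of (c, d) \<Rightarrow> \<bar>f d - f c\<bar>) = sum ((\<lambda>(c, d). \<bar>f d - f c\<bar>) \<circ> \<iota>) q"
        by (rule sum.reindex_nontrivial[OF \<open>finite q\<close>]) (rule degen)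
      also have "\<dots> = (\<Sum>i\<in>q. \<bar>E i\<bar>)"
        by (rule sum.cong) (auto simp: \<iota>_def E_def q_def g_def)
      finally have on_N: "(\<Sum>i\<in>q. \<bar>E i\<bar>) < e / 2 * (b - a)"
        using \<delta>[OF _ _ pw small] \<open>finite q\<close> by (force simp: \<iota>_def q_def dest: ends)
      \<comment> \<open>Straddle argument: splitting \<open>K\<close> at its tag \<open>x\<close>
        writes the error as a difference of two linearization errors, at \<open>u\<close> and at
        \<open>v\<close>, with weights \<open>x - u\<close> and \<open>v - x\<close> that add up to
        the length of \<open>K\<close>.\<close>
      have "\<bar>E (x, K)\<bar> \<le> e / 2 * measure lborel K" if "(x, K) \<in> p - q" for x K
      proof -
        have xK: "(x, K) \<in> p" "x \<notin> N"
          using that by (auto simp: q_def)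
        define u v where "u = Inf K" and "v = Sup K"
        have uv: "K = {u..v}" "u \<le> x" "x \<le> v" "a \<le> u" "v \<le> b" "K \<subseteq> \<gamma> x"
          using box[OF xK(1)] by (auto simp: u_def v_def)
        have x: "x \<in> {a..b} - N"
          using uv xK by auto
        have "u \<in> K" "v \<in> K" "\<gamma> x = ball x (d x)"
          using uv(1,2,3) x by (auto simp: \<gamma>_def)
        then have "u \<in> ball x (d x)" "v \<in> ball x (d x)"
          using uv(6) by blast+
        then have "\<bar>u - x\<bar> < d x" "\<bar>v - x\<bar> < d x"
          by (auto simp: dist_real_def)
        then have "\<bar>f u - f x - f' x * (u - x)\<bar> \<le> e / 2 * (x - u)"
          "\<bar>f v - f x - f' x * (v - x)\<bar> \<le> e / 2 * (v - x)"
          using d(2)[OF x] uv by (metis abs_minus_commute abs_of_nonneg diff_ge_0_iff_ge)+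
        moreover have "E (x, K) = (f u - f x - f' x * (u - x)) - (f v - f x - f' x * (v - x))"
          using xK(2) uv by (simp add: E_def g_def u_def[symmetric] v_def[symmetric] algebra_simps)
        moreover have "e / 2 * measure lborel K = e / 2 * (x - u) + e / 2 * (v - x)"
          using uv by (simp add: field_simps)
        ultimately show ?thesis
          by linarith
      qed
      then have "(\<Sum>i\<in>p - q. \<bar>E i\<bar>) \<le> (\<Sum>i\<in>p - q. e / 2 * measure lborel (snd i))"
        by (intro sum_mono) (metis prod.collapse)
      also have "\<dots> \<le> (\<Sum>i\<in>p. e / 2 * measure lborel (snd i))"
        by (rule sum_mono2) (use \<open>finite p\<close> \<open>e > 0\<close> in auto)
      also have "\<dots> = e / 2 * (b - a)"
        unfolding sum_distrib_left[symmetric]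
        using additive_content_tagged_division[of p a b] p \<open>a < b\<close> by (simp add: case_prod_unfold)
      finally have off_N: "(\<Sum>i\<in>p - q. \<bar>E i\<bar>) \<le> e / 2 * (b - a)" .
      have "\<bar>sum E p\<bar> \<le> (\<Sum>i\<in>p. \<bar>E i\<bar>)"
        by (rule sum_abs)
      also have "\<dots> = (\<Sum>i\<in>p - q. \<bar>E i\<bar>) + (\<Sum>i\<in>q. \<bar>E i\<bar>)"
        by (rule sum.subset_diff) (use \<open>q \<subseteq> p\<close> \<open>finite p\<close> in auto)
      also have "\<dots> \<le> e * measure lborel {a..b}"
        using off_N on_N \<open>a < b\<close> by (simp add: algebra_simps)
      finally show "norm ((\<Sum>(x, K)\<in>p. measure lborel K *\<^sub>R g x) - (f b - f a)) \<le> e * measure lborel {a..b}"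
        unfolding total by simp
    qed
  qed
  then show ?thesis
    by (rule has_integral_spike[OF N, rotated]) (simp add: g_def)
qed

text \<open>The source of all estimates on solutions below: an almost everywhere bound on the
  derivative becomes a bound on increments. The endpoints join the null set, because the bound is
  assumed on the open interval only.\<close>

lemma abs_cont_le_integral:
  fixes f g :: "real \<Rightarrow> real"
  assumes "a \<le> b" and "abs_cont_on_Icc a b f" and g: "g integrable_on {a..b}"
    and ae: "AE t in lebesgue. t \<in> {a<..<b} \<longrightarrow> (\<exists>D. (f has_real_derivative D) (at t) \<and> D \<le> g t)"
  shows "f b - f a \<le> integral {a..b} g"
proof -
  obtain N where N: "{t. \<not> (t \<in> {a<..<b} \<longrightarrow> (\<exists>D. (f has_real_derivative D) (at t) \<and> D \<le> g t))} \<subseteq> N"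
    "N \<in> null_sets lebesgue"
    using ae unfolding eventually_ae_filter by auto
  define N' where "N' = insert a (insert b N)"
  have "negligible N'"
    using N(2) by (simp add: N'_def negligible_iff_null_sets[symmetric])
  have good: "(f has_real_derivative deriv f t) (at t) \<and> deriv f t \<le> g t" if "t \<in> {a..b} - N'" for t
  proof -
    have "t \<in> {a<..<b}" "t \<notin> N"
      using that by (auto simp: N'_def)
    then show ?thesis
      using N(1) DERIV_imp_deriv by blast
  qed
  have "(deriv f has_integral (f b - f a)) {a..b}"
    using abs_cont_has_integral[OF assms(1,2) \<open>negligible N'\<close>, of "deriv f"] good by blast
  \<comment> \<open>\<open>has_integral_le\<close> compares integrands at every point, so
    \<open>g\<close> is changed to \<open>deriv f\<close> on the null set.\<close>
  moreover have "((\<lambda>t. if t \<in> N' then deriv f t else g t) has_integral integral {a..b} g) {a..b}"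
    by (rule has_integral_spike[OF \<open>negligible N'\<close> _ integrable_integral[OF g]]) simp
  ultimately show ?thesis
    by (rule has_integral_le) (use good in auto)
qed

lemma abs_cont_antimono:
  fixes f :: "real \<Rightarrow> real"
  assumes "a \<le> b" "abs_cont_on_Icc a b f"
    and "AE t in lebesgue. t \<in> {a<..<b} \<longrightarrow> (\<exists>D. (f has_real_derivative D) (at t) \<and> D \<le> 0)"
  shows "f b \<le> f a"
  using abs_cont_le_integral[OF assms(1,2), of "\<lambda>_. 0"] assms(3) by auto

subsection \<open>Averages with respect to the kernel\<close>

lemma mono_tendsto_right_lim:
  fixes G :: "real \<Rightarrow> real"
  assumes "mono G"
  shows "(G \<longlongrightarrow> (INF s\<in>{a<..}. G s)) (at_right a)"
proof (rule order_tendstoI)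
  have bdd: "bdd_below (G ` {a<..})"
    using assms by (intro bdd_belowI[of _ "G a"]) (use monoD[OF assms, of a] in auto)
  fix c
  {
    assume "c < (INF s\<in>{a<..}. G s)"
    then have "c < G s" if "s > a" for s
      using cINF_lower[OF bdd, of s] that by simp
    then show "\<forall>\<^sub>F s in at_right a. c < G s"
      by (auto simp: eventually_at_filter)
  next
    assume "(INF s\<in>{a<..}. G s) < c"
    then obtain b where b: "b > a" "G b < c"
      using cINF_less_iff[OF _ bdd] by auto
    then have "G s < c" if "a < s" "s < b" for s
      using that monoD[OF assms, of s b] by simp
    then show "\<forall>\<^sub>F s in at_right a. G s < c"
      using b(1) by (auto simp: eventually_at_right_field)
  }
qed

text \<open>With \<open>F\<close> the right limits of \<open>G\<close>, the half-open interval from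
  \<open>c\<close> to \<open>b\<close> has mass \<open>F b - F c\<close>. Letting \<open>c\<close>
  increase to \<open>a\<close> includes the atom at \<open>a\<close>: \<open>F c\<close> lies
  between \<open>G c\<close> and \<open>G a\<close>, so left continuity of \<open>G\<close> at
  \<open>a\<close> gives the limit \<open>G a\<close>.\<close>

lemma emeasure_left_stieltjes_Icc:
  fixes G :: "real \<Rightarrow> real"
  assumes G: "mono G" and left: "continuous (at_left a) G"
    and right: "(G \<longlongrightarrow> m) (at_right b)" and "a \<le> b"
  shows "emeasure (left_stieltjes_measure G) {a..b} = ennreal (m - G a)"
proof -
  define F where "F s = (INF u\<in>{s<..}. G u)" for s
  have F_lim: "(G \<longlongrightarrow> F s) (at_right s)" for s
    unfolding F_def by (rule mono_tendsto_right_lim[OF G])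
  have bdd: "bdd_below (G ` {s<..})" for s
    using G by (intro bdd_belowI[of _ "G s"]) (use monoD[OF G, of s] in auto)
  have F_le: "F s \<le> G u" if "s < u" for s u
    unfolding F_def using cINF_lower[OF bdd, of u s] that by simp
  have F_ge: "G s \<le> F s" for s
    unfolding F_def by (rule cINF_greatest) (use monoD[OF G, of s] in auto)
  have F_mono: "F s \<le> F u" if "s \<le> u" for s u
  proof (cases "s = u")
    case False
    then have "F s \<le> G u"
      using that by (intro F_le) simp
    then show ?thesis
      using F_ge[of u] by simp
  qed simp
  have F_cont: "continuous (at_right s) F" for s
  proof -
    have "(F \<longlongrightarrow> F s) (at_right s)"
    proof (rule order_tendstoI)
      fix c assume "c < F s"
      then have "c < F u" if "s < u" for u
        using F_mono[of s u] that by simp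
      then show "\<forall>\<^sub>F u in at_right s. c < F u"
        by (auto simp: eventually_at_filter)
    next
      fix c assume "F s < c"
      then obtain b where b: "b > s" "G b < c"
        unfolding F_def using cINF_less_iff[OF _ bdd] by auto
      then have "F u < c" if "s < u" "u < b" for u
        using F_le[OF that(2)] by simp
      then show "\<forall>\<^sub>F u in at_right s. F u < c"
        using b(1) by (auto simp: eventually_at_right_field)
    qed
    then show ?thesis
      by (simp add: continuous_within)
  qed
  have "F b = m"
    using tendsto_unique[OF _ F_lim right] by simp
  have M: "left_stieltjes_measure G = interval_measure F"
    unfolding left_stieltjes_measure_def
    by (rule arg_cong[where f = interval_measure]) (auto intro!: tendsto_Lim F_lim)
  have Ioc: "emeasure (interval_measure F) {c<..b} = ennreal (F b - F c)" if "c \<le> b" for c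
    using emeasure_interval_measure_Ioc[OF that, of F] F_mono F_cont by simp
  define c where "c n = a - inverse (real (Suc n))" for n
  have "c n < a" for n
    by (simp add: c_def)
  then have c: "c n < a" "c n \<le> b" for n
    using \<open>a \<le> b\<close> by (auto intro: order.strict_implies_order less_le_trans)
  have c_lim: "c \<longlonglongrightarrow> a"
    unfolding c_def using tendsto_diff[OF tendsto_const LIMSEQ_inverse_real_of_nat] by simp
  have "incseq c"
    unfolding c_def by (intro incseq_SucI) (simp add: field_simps)
  have "(\<Inter>n. {c n<..b}) = {a..b}"
  proof safe
    fix s assume s: "s \<in> (\<Inter>n. {c n<..b})"
    have "c n \<le> s" for n
      using s by (simp add: order.strict_implies_order)
    then have "a \<le> s"
      by (intro LIMSEQ_le_const2[OF c_lim]) auto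
    then show "s \<in> {a..b}"
      using s by simp
  next
    fix s n assume "s \<in> {a..b}"
    then show "s \<in> {c n<..b}"
      using c(1)[of n] by simp
  qed
  moreover have "(\<lambda>n. emeasure (interval_measure F) {c n<..b}) \<longlonglongrightarrow> emeasure (interval_measure F) (\<Inter>n. {c n<..b})"
  proof (rule Lim_emeasure_decseq)
    show "decseq (\<lambda>n. {c n<..b})"
      using le_less_trans[OF incseqD[OF \<open>incseq c\<close>]] by (auto simp: decseq_def)
  qed (auto simp: Ioc[OF c(2)])
  moreover have "(\<lambda>n. F (c n)) \<longlonglongrightarrow> G a"
  proof (rule tendsto_sandwich)
    have "filterlim c (at_left a) sequentially"
      using c_lim c(1) by (simp add: filterlim_at less_imp_neq)
    moreover have "(G \<longlongrightarrow> G a) (at_left a)"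
      using left by (simp add: continuous_within)
    ultimately show "(\<lambda>n. G (c n)) \<longlonglongrightarrow> G a"
      by (rule filterlim_compose[rotated])
  qed (use F_ge F_le c(1) in auto)
  then have lim: "(\<lambda>n. ennreal (F b - F (c n))) \<longlonglongrightarrow> ennreal (F b - G a)"
    by (intro tendsto_ennrealI tendsto_diff tendsto_const)
  ultimately have "(\<lambda>n. ennreal (F b - F (c n))) \<longlonglongrightarrow> emeasure (interval_measure F) {a..b}"
    by (simp add: Ioc[OF c(2)])
  from LIMSEQ_unique[OF this lim] show ?thesis
    by (simp add: M \<open>F b = m\<close>)
qed

text \<open>The kernel is 0 at \<open>h t\<close> and has right limit 1 at \<open>t\<close>, so the
  closed interval has mass 1, and the integral, being a mean of \<open>g\<close>, lies between any
  two constants that enclose \<open>g\<close>.\<close>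

lemma delay_integral_bounds:
  assumes "admissible_kernel h R" "0 \<le> t" "h t \<le> t"
    and g: "continuous_on {h t..t} g" and bounds: "\<And>s. s \<in> {h t..t} \<Longrightarrow> l \<le> g s \<and> g s \<le> u"
  shows "l \<le> delay_integral h R g t" "delay_integral h R g t \<le> u"
proof -
  define M where "M = left_stieltjes_measure (R t)"
  have sets: "sets M = sets borel"
    by (simp add: M_def left_stieltjes_measure_def)
  have "emeasure M {h t..t} = 1"
    using emeasure_left_stieltjes_Icc[of "R t" "h t" 1 t] assms(1-3)
    unfolding admissible_kernel_def M_def by simp
  then have mass: "measure M {h t..t} = 1"
    by (simp add: measure_def)
  have meas: "set_borel_measurable M {h t..t} g"
    using borel_measurable_continuous_on_indicator[OF _ g] sets
    by (simp add: set_borel_measurable_def measurable_cong_sets[OF sets refl])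
  have const: "set_integrable M {h t..t} (\<lambda>_. c)" for c :: real
    using \<open>emeasure M {h t..t} = 1\<close> sets by (simp add: set_integrable_def)
  have int: "set_integrable M {h t..t} g"
  proof (rule set_integrable_bound[OF const[of "\<bar>l\<bar> + \<bar>u\<bar>"] meas])
    have "norm (g s) \<le> norm (\<bar>l\<bar> + \<bar>u\<bar>)" if "s \<in> {h t..t}" for s
      using bounds[OF that] by auto
    then show "AE s in M. s \<in> {h t..t} \<longrightarrow> norm (g s) \<le> norm (\<bar>l\<bar> + \<bar>u\<bar>)"
      by simp
  qed
  have const_val: "(LINT s:{h t..t}|M. c) = c" for c :: real
    using set_integral_const[of "{h t..t}" M c] \<open>emeasure M {h t..t} = 1\<close> mass sets by simp
  have "(LINT s:{h t..t}|M. l) \<le> (LINT s:{h t..t}|M. g s)"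
    by (rule set_integral_mono[OF const int]) (use bounds in auto)
  then show "l \<le> delay_integral h R g t"
    by (simp add: delay_integral_def const_val M_def[symmetric])
  have "(LINT s:{h t..t}|M. g s) \<le> (LINT s:{h t..t}|M. u)"
    by (rule set_integral_mono[OF int const]) (use bounds in auto)
  then show "delay_integral h R g t \<le> u"
    by (simp add: delay_integral_def const_val M_def[symmetric])
qed

subsection \<open>Differential inequalities\<close>

text \<open>Provides the last or the first time at which a continuous function is at or below a
  level.\<close>

lemma compact_sublevel_Icc:
  fixes g :: "real \<Rightarrow> real"
  assumes "continuous_on {a..b} g"
  shows "compact {t \<in> {a..b}. g t \<le> c}"
  unfolding compact_eq_bounded_closed
proof
  show "bounded {t \<in> {a..b}. g t \<le> c}"
    by (rule bounded_subset[OF bounded_closed_interval[of a b]]) auto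
  show "closed {t \<in> {a..b}. g t \<le> c}"
    using assms by (intro continuous_on_closed_Collect_le continuous_on_const closed_atLeastAtMost)
qed

lemma AE_derivative_le_mono:
  fixes u :: "real \<Rightarrow> real"
  assumes "AE t in lebesgue. t \<in> A \<longrightarrow> (\<exists>D. (u has_real_derivative D) (at t) \<and> D \<le> p t)"
    and "\<And>t. t \<in> B \<Longrightarrow> t \<in> A" and le: "\<And>t. t \<in> B \<Longrightarrow> p t \<le> q t"
  shows "AE t in lebesgue. t \<in> B \<longrightarrow> (\<exists>D. (u has_real_derivative D) (at t) \<and> D \<le> q t)"
  using assms(1)
proof eventually_elim
  case (elim t)
  then show ?case
    using assms(2)[of t] le[of t] by (metis order.trans)
qed

text \<open>After the last time \<open>s\<close> with \<open>u s\<close> at most \<open>M\<close>,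
  the function stays above \<open>L\<close>, so its derivative is nonpositive almost everywhere and
  it cannot climb above \<open>M\<close> by time \<open>b\<close>.\<close>

lemma abs_cont_upper_barrier:
  fixes u r :: "real \<Rightarrow> real"
  assumes "a \<le> b" and ac: "abs_cont_on_Icc a b u" and r: "\<And>t. a \<le> t \<Longrightarrow> r t \<ge> 0"
    and ae: "AE t in lebesgue. t \<in> {a<..<b} \<longrightarrow> (\<exists>D. (u has_real_derivative D) (at t) \<and> D \<le> r t * (L - u t))"
  shows "u b \<le> max (u a) L"
proof (rule ccontr)
  define M where "M = max (u a) L"
  assume "\<not> u b \<le> max (u a) L"
  then have "u b > M"
    unfolding M_def by linarith
  define S where "S = {t \<in> {a..b}. u t \<le> M}"
  have "compact S"
    unfolding S_def by (intro compact_sublevel_Icc abs_cont_on_Icc_imp_continuous_on ac)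
  moreover have "S \<noteq> {}"
    using \<open>a \<le> b\<close> by (auto simp: S_def M_def)
  ultimately obtain s where s: "s \<in> S" "\<And>t. t \<in> S \<Longrightarrow> t \<le> s"
    using compact_attains_sup by metis
  have "r t * (L - u t) \<le> 0" if "t \<in> {s<..<b}" for t
  proof -
    have "t \<notin> S"
      using s(2)[of t] that by auto
    then have "u t > L"
      using s(1) that by (auto simp: S_def M_def)
    then show ?thesis
      using r[of t] s(1) that by (intro mult_nonneg_nonpos) (auto simp: S_def)
  qed
  then have "AE t in lebesgue. t \<in> {s<..<b} \<longrightarrow> (\<exists>D. (u has_real_derivative D) (at t) \<and> D \<le> 0)"
    by (intro AE_derivative_le_mono[OF ae]) (use s(1) in \<open>auto simp: S_def\<close>)
  then have "u b \<le> u s"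
    by (rule abs_cont_antimono[OF _ abs_cont_on_Icc_subset[OF ac], rotated 3]) (use s(1) in \<open>auto simp: S_def\<close>)
  then show False
    using s(1) \<open>u b > M\<close> by (simp add: S_def)
qed

section \<open>Rates: local integrability and divergence of the integral\<close>

lemma admissible_rate_integrable:
  assumes r: "admissible_rate r" and "0 \<le> a"
  shows "integrable (lebesgue_on {a..b}) r"
proof -
  obtain C where C: "AE t in lebesgue_on {0..}. \<bar>r t\<bar> \<le> C"
    using r by (auto simp: admissible_rate_def)
  have sub: "{a..b} \<subseteq> {0..}"
    using \<open>0 \<le> a\<close> by auto
  have "r \<in> borel_measurable (lebesgue_on {a..b})"
    by (rule measurable_restrict_mono[OF _ sub]) (use r in \<open>simp add: admissible_rate_def\<close>)
  moreover have "AE t in lebesgue. t \<in> {a..b} \<longrightarrow> \<bar>r t\<bar> \<le> C"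
    using C sub by (subst (asm) AE_restrict_space_iff) auto
  then have "AE t in lebesgue_on {a..b}. norm (r t) \<le> C"
    by (subst AE_restrict_space_iff) auto
  ultimately show ?thesis
    by (intro finite_measure.integrable_const_bound[where B = C] finite_measure_lebesgue_on) auto
qed

text \<open>If the integrals from \<open>a\<close> were bounded, so would be those over
  \<open>{0..a + real n}\<close>, and monotone convergence would make the total integral finite. The
  proof also passes from the nonnegative Lebesgue integral of the hypothesis to the gauge integral
  of the differential inequalities.\<close>

lemma admissible_rate_integral_unbounded:
  assumes r: "admissible_rate r" and "0 \<le> a"
  obtains T where "T \<ge> a" "integral {a..T} r > K"
proof -
  have nonneg: "r t \<ge> 0" if "t \<ge> 0" for t
    using r that by (auto simp: admissible_rate_def)
  have int_on: "r integrable_on {c..d}" if "0 \<le> c" for c d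
    using admissible_rate_integrable[OF r that] by (intro integrable_on_lebesgue_on) auto
  have "\<exists>T\<ge>a. integral {a..T} r > K"
  proof (rule ccontr)
    assume "\<not> (\<exists>T\<ge>a. integral {a..T} r > K)"
    then have bound: "integral {a..T} r \<le> K" if "T \<ge> a" for T
      using that by force
    define B where "B = integral {0..a} r + K"
    have le_B: "integral {0..T} r \<le> B" if "T \<ge> a" for T
      using Henstock_Kurzweil_Integration.integral_combine[OF \<open>0 \<le> a\<close> that int_on] bound[OF that] by (simp add: B_def)
    have piece: "(\<integral>\<^sup>+t. ennreal (r t) * indicator {0..a + real n} t \<partial>lebesgue_on {0..}) \<le> ennreal B" for n
    proof -
      have "(\<integral>\<^sup>+t. ennreal (r t) * indicator {0..a + real n} t \<partial>lebesgue_on {0..})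
          = (\<integral>\<^sup>+t. ennreal (r t) \<partial>lebesgue_on {0..a + real n})"
        by (auto simp: nn_integral_restrict_space mult.assoc indicator_def intro!: nn_integral_cong)
      also have "\<dots> = ennreal (integral\<^sup>L (lebesgue_on {0..a + real n}) r)"
        by (rule nn_integral_eq_integral[OF admissible_rate_integrable[OF r]])
          (use nonneg in \<open>auto simp: AE_restrict_space_iff\<close>)
      also have "\<dots> = ennreal (integral {0..a + real n} r)"
        by (subst lebesgue_integral_eq_integral) (auto intro: admissible_rate_integrable[OF r])
      finally show ?thesis
        using le_B[of "a + real n"] by (simp add: ennreal_leI)
    qed
    have "(\<integral>\<^sup>+t. ennreal (r t) \<partial>lebesgue_on {0..})
        = (\<integral>\<^sup>+t. (SUP n. ennreal (r t) * indicator {0..a + real n} t) \<partial>lebesgue_on {0..})"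
    proof (rule nn_integral_cong)
      fix t assume "t \<in> space (lebesgue_on {0 :: real..})"
      then have "t \<ge> 0"
        by simp
      obtain n :: nat where n: "t \<le> real n"
        using real_arch_simple by blast
      have "(SUP n. ennreal (r t) * indicator {0..a + real n} t) = ennreal (r t)"
      proof (rule antisym)
        show "(SUP n. ennreal (r t) * indicator {0..a + real n} t) \<le> ennreal (r t)"
          by (rule SUP_least) (auto simp: indicator_def)
        show "ennreal (r t) \<le> (SUP n. ennreal (r t) * indicator {0..a + real n} t)"
          by (rule SUP_upper2[of n]) (use n \<open>t \<ge> 0\<close> \<open>0 \<le> a\<close> in auto)
      qed
      then show "ennreal (r t) = (SUP n. ennreal (r t) * indicator {0..a + real n} t)"
        by simp
    qed
    also have "\<dots> = (SUP n. \<integral>\<^sup>+t. ennreal (r t) * indicator {0..a + real n} t \<partial>lebesgue_on {0..})"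
    proof (rule nn_integral_monotone_convergence_SUP)
      show "incseq (\<lambda>n t. ennreal (r t) * indicator {0..a + real n} t)"
        by (auto simp: incseq_def le_fun_def indicator_def)
      have [measurable]: "r \<in> borel_measurable (lebesgue_on {0..})"
        using r by (simp add: admissible_rate_def)
      show "(\<lambda>t. ennreal (r t) * indicator {0..a + real n} t) \<in> borel_measurable (lebesgue_on {0..})" for n
        by (intro borel_measurable_times_ennreal borel_measurable_indicator)
          (auto simp: sets_restrict_space_iff)
    qed
    also have "\<dots> \<le> ennreal B"
      using piece by (rule SUP_least)
    finally show False
      using r by (simp add: admissible_rate_def top_unique)
  qed
  then show ?thesis
    using that by blast
qed

text \<open>As long as \<open>u\<close> exceeds \<open>L'\<close>, it falls at least at rate
  \<open>(L' - L) * r t\<close>, whose integral diverges; hence \<open>u\<close> reaches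
  \<open>L'\<close> at some time. From then on \<open>abs_cont_upper_barrier\<close> keeps it
  there.\<close>

lemma abs_cont_eventually_le:
  fixes u r :: "real \<Rightarrow> real"
  assumes "0 \<le> a" and ac: "\<And>c d. a \<le> c \<Longrightarrow> abs_cont_on_Icc c d u" and r: "admissible_rate r"
    and ae: "AE t in lebesgue. t \<in> {a<..} \<longrightarrow> (\<exists>D. (u has_real_derivative D) (at t) \<and> D \<le> r t * (L - u t))"
    and "L < L'"
  shows "\<forall>\<^sub>F t in at_top. u t \<le> L'"
proof -
  have nonneg: "r t \<ge> 0" if "t \<ge> a" for t
    using r that \<open>0 \<le> a\<close> by (auto simp: admissible_rate_def)
  have "\<exists>T\<ge>a. u T \<le> L'"
  proof (rule ccontr)
    assume "\<not> (\<exists>T\<ge>a. u T \<le> L')"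
    then have above: "u t > L'" if "t \<ge> a" for t
      using that by force
    \<comment> \<open>The threshold makes the guaranteed drop
      \<open>(L' - L) * integral {a..T} r\<close> larger than \<open>u a - L'\<close>.\<close>
    obtain T where T: "T \<ge> a" "integral {a..T} r > (u a - L') / (L' - L)"
      using admissible_rate_integral_unbounded[OF r \<open>0 \<le> a\<close>] .
    have int: "r integrable_on {a..T}"
      using admissible_rate_integrable[OF r \<open>0 \<le> a\<close>] by (intro integrable_on_lebesgue_on) auto
    have "r t * (L - u t) \<le> (L - L') * r t" if "a < t" for t
      using mult_left_mono[of "L - u t" "L - L'" "r t"] above[of t] nonneg[of t] that by (simp add: mult.commute)
    then have "AE t in lebesgue. t \<in> {a<..<T} \<longrightarrow> (\<exists>D. (u has_real_derivative D) (at t) \<and> D \<le> (L - L') * r t)"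
      by (intro AE_derivative_le_mono[OF ae]) auto
    then have "u T - u a \<le> integral {a..T} (\<lambda>t. (L - L') * r t)"
      by (intro abs_cont_le_integral T(1) ac integrable_on_mult_right int) auto
    also have "\<dots> = - ((L' - L) * integral {a..T} r)"
      unfolding minus_mult_left by simp
    also have "\<dots> < - (u a - L')"
      using T(2) \<open>L < L'\<close> by (simp add: field_simps)
    finally show False
      using above[OF T(1)] by simp
  qed
  then obtain T where T: "T \<ge> a" "u T \<le> L'"
    by blast
  have "u t \<le> L'" if "t \<ge> T" for t
  proof -
    have "AE s in lebesgue. s \<in> {T<..<t} \<longrightarrow> (\<exists>D. (u has_real_derivative D) (at s) \<and> D \<le> r s * (L - u s))"
      by (intro AE_derivative_le_mono[OF ae]) (use T in auto)
    then have "u t \<le> max (u T) L"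
      by (rule abs_cont_upper_barrier[OF that ac[OF T(1)], rotated]) (use nonneg T in auto)
    then show ?thesis
      using T(2) \<open>L < L'\<close> by simp
  qed
  then show ?thesis
    unfolding eventually_at_top_linorder by blast
qed

text \<open>On an interval of length \<open>1 / (2 C)\<close>, \<open>u\<close> cannot lose more than half of its maximum.\<close>

lemma abs_cont_positive:
  fixes u :: "real \<Rightarrow> real"
  assumes "a < b" and ac: "abs_cont_on_Icc a b u" and pos: "\<And>t. t \<in> {a..<b} \<Longrightarrow> u t > 0"
    and "C > 0"
    and ae: "AE t in lebesgue. t \<in> {a<..<b} \<longrightarrow> (\<exists>D. (u has_real_derivative D) (at t) \<and> D \<ge> - C * u t)"
  shows "u b > 0"
proof -
  define a' where "a' = max a (b - 1 / (2 * C))"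
  have a': "a \<le> a'" "a' < b" "b - a' \<le> 1 / (2 * C)"
    using \<open>a < b\<close> \<open>C > 0\<close> by (auto simp: a'_def)
  have "continuous_on {a'..b} u"
    using abs_cont_on_Icc_imp_continuous_on[OF ac] by (rule continuous_on_subset) (use a' in auto)
  \<comment> \<open>At the maximum point \<open>s\<close> of the window, \<open>u s\<close> is
    positive. Afterwards \<open>u\<close> falls at rate at most \<open>C * u s\<close>, over a time
    of at most \<open>1 / (2 * C)\<close>, so at least \<open>u s / 2\<close> is left at
    \<open>b\<close>.\<close>
  then obtain s where s: "s \<in> {a'..b}" "\<And>t. t \<in> {a'..b} \<Longrightarrow> u t \<le> u s"
    using continuous_attains_sup[of "{a'..b}" u] a' by auto
  have "u s > 0"
    using s(2)[of a'] pos[of a'] a' by auto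
  have bound: "- u t \<ge> - u s" if "t \<in> {s<..<b}" for t
    using s that by auto
  have "AE t in lebesgue. t \<in> {s<..<b} \<longrightarrow> (\<exists>D. ((\<lambda>t. - u t) has_real_derivative D) (at t) \<and> D \<le> C * u s)"
    using ae
  proof eventually_elim
    case (elim t)
    show ?case
    proof
      assume t: "t \<in> {s<..<b}"
      then obtain D where D: "(u has_real_derivative D) (at t)" "D \<ge> - C * u t"
        using elim s(1) a' by auto
      have "- D \<le> C * u s"
      proof -
        have "C * u t \<le> C * u s"
          using bound[OF t] \<open>C > 0\<close> by simp
        then show ?thesis
          using D(2) by linarith
      qed
      with DERIV_minus[OF D(1)] show "\<exists>D. ((\<lambda>t. - u t) has_real_derivative D) (at t) \<and> D \<le> C * u s"
        by blast
    qed
  qed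
  moreover have "abs_cont_on_Icc s b (\<lambda>t. - u t)"
    by (rule abs_cont_on_Icc_subset[OF abs_cont_on_Icc_minus[OF ac]]) (use s a' in auto)
  ultimately have "- u b - (- u s) \<le> integral {s..b} (\<lambda>_. C * u s)"
    using s(1) by (intro abs_cont_le_integral) auto
  also have "\<dots> = (b - s) * (C * u s)"
    using s(1) by simp
  also have "\<dots> \<le> 1 / (2 * C) * (C * u s)"
    using s(1) a' \<open>C > 0\<close> \<open>u s > 0\<close> by (intro mult_right_mono) auto
  also have "\<dots> = u s / 2"
    using \<open>C > 0\<close> by simp
  finally show ?thesis
    using \<open>u s > 0\<close> by simp
qed

text \<open>The first point where \<open>g\<close> is nonpositive would violate \<open>step\<close>.
  In this form, positivity of solutions and the invariance of rectangles only require excluding a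
  first exit time.\<close>

lemma positive_by_first_zero:
  fixes g :: "real \<Rightarrow> real"
  assumes cont: "continuous_on {a..} g" and "g a > 0"
    and step: "\<And>t. a < t \<Longrightarrow> (\<And>s. s \<in> {a..<t} \<Longrightarrow> g s > 0) \<Longrightarrow> g t > 0"
    and "a \<le> t"
  shows "g t > 0"
proof (rule ccontr)
  assume "\<not> g t > 0"
  define S where "S = {s \<in> {a..t}. g s \<le> 0}"
  have "continuous_on {a..t} g"
    using cont by (rule continuous_on_subset) auto
  then have "compact S"
    unfolding S_def by (rule compact_sublevel_Icc)
  moreover have "t \<in> S"
    using \<open>a \<le> t\<close> \<open>\<not> g t > 0\<close> by (auto simp: S_def)
  ultimately obtain m where m: "m \<in> S" "\<And>s. s \<in> S \<Longrightarrow> m \<le> s"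
    using compact_attains_inf[of S] by blast
  have "m \<noteq> a"
    using m(1) \<open>g a > 0\<close> by (auto simp: S_def)
  have "g m > 0"
  proof (rule step)
    fix s assume "s \<in> {a..<m}"
    then show "g s > 0"
      using m(1) m(2)[of s] by (force simp: S_def)
  qed (use m(1) \<open>m \<noteq> a\<close> in \<open>auto simp: S_def\<close>)
  then show False
    using m(1) by (simp add: S_def)
qed

section \<open>Order and one-sided continuity of the nonlinearities\<close>

lemma admissible_nonlinearity_nonneg:
  "admissible_nonlinearity f \<Longrightarrow> 0 \<le> z \<Longrightarrow> 0 \<le> f z"
  unfolding admissible_nonlinearity_def by auto

lemma admissible_nonlinearity_pos:
  "admissible_nonlinearity f \<Longrightarrow> 0 < z \<Longrightarrow> 0 < f z"
  unfolding admissible_nonlinearity_def by auto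

lemma admissible_nonlinearity_le_iff:
  "admissible_nonlinearity f \<Longrightarrow> 0 \<le> z \<Longrightarrow> 0 \<le> w \<Longrightarrow> f z \<le> f w \<longleftrightarrow> z \<le> w"
  unfolding admissible_nonlinearity_def by (auto simp: strict_mono_on_less_eq)

text \<open>Together with its left-sided counterpart, this creates the slack needed because bounds
  on a component pass to the next one only with a strict loss.\<close>

lemma admissible_nonlinearity_less_right:
  assumes "admissible_nonlinearity f" "0 \<le> z" "f z < w"
  obtains z' where "z < z'" "f z' < w"
proof -
  have "continuous_on {z..} f"
    using assms(1,2) unfolding admissible_nonlinearity_def by (auto intro: continuous_on_subset)
  then have "(f \<longlongrightarrow> f z) (at_right z)"
    by (auto simp: continuous_on_def intro: tendsto_within_subset)
  then have "\<forall>\<^sub>F s in at_right z. f s < w"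
    using assms(3) by (rule order_tendstoD)
  then have "\<forall>\<^sub>F s in at_right z. f s < w \<and> z < s"
    by (rule eventually_conj) (simp add: eventually_at_filter)
  from eventually_happens'[OF trivial_limit_at_right_real this] show ?thesis
    using that by blast
qed

lemma admissible_nonlinearity_greater_left:
  assumes "admissible_nonlinearity f" "0 < z" "w < f z"
  obtains z' where "0 \<le> z'" "z' < z" "w < f z'"
proof -
  have "continuous_on {0..} f"
    using assms(1) unfolding admissible_nonlinearity_def by auto
  then have "(f \<longlongrightarrow> f z) (at z within {0..})"
    using assms(2) by (auto simp: continuous_on_def)
  \<comment> \<open>Continuity is known on \<open>{0..}\<close> only; as \<open>z\<close> is
    positive, approaching \<open>z\<close> inside \<open>{0..z}\<close> is the same as approaching
    it from the left.\<close>
  then have "(f \<longlongrightarrow> f z) (at z within {0..z})"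
    by (rule tendsto_within_subset) auto
  then have "(f \<longlongrightarrow> f z) (at_left z)"
    using assms(2) by (simp add: at_within_Icc_at_left)
  then have "\<forall>\<^sub>F s in at_left z. w < f s"
    using assms(3) by (rule order_tendstoD)
  then have "\<forall>\<^sub>F s in at_left z. w < f s \<and> s \<in> {0<..<z}"
    using eventually_at_left_real[OF assms(2)] by (rule eventually_conj)
  from eventually_happens'[OF trivial_limit_at_left_real this] obtain s where "w < f s" "s \<in> {0<..<z}"
    by blast
  then show ?thesis
    using that[of s] by simp
qed

subsection \<open>One delayed equation\<close>

text \<open>A single equation whose input \<open>y\<close> is treated as a given continuous
  function. The system consists of two instances with the roles of \<open>x\<close> and
  \<open>y\<close> exchanged.\<close>

locale delay_component =
  fixes f h r x y :: "real \<Rightarrow> real" and R :: "real \<Rightarrow> real \<Rightarrow> real"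
  assumes f: "admissible_nonlinearity f" and h: "admissible_delay h"
    and R: "admissible_kernel h R" and r: "admissible_rate r"
    and ac: "loc_abs_cont_nonneg x" and cont_y: "continuous_on UNIV y"
    and deriv: "AE t in lebesgue. t \<ge> 0 \<longrightarrow>
      (x has_real_derivative r t * (delay_integral h R (\<lambda>s. f (y s)) t - x t)) (at t)"
begin

abbreviation "I \<equiv> delay_integral h R (\<lambda>s. f (y s))"

lemma h_le: "0 \<le> t \<Longrightarrow> h t \<le> t"
  using h by (simp add: admissible_delay_def)

lemma r_nonneg: "0 \<le> t \<Longrightarrow> 0 \<le> r t"
  using r by (simp add: admissible_rate_def)

lemma f_y_continuous:
  assumes "\<And>s. s \<in> S \<Longrightarrow> 0 \<le> y s"
  shows "continuous_on S (\<lambda>s. f (y s))"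
proof (rule continuous_on_compose2[of "{0..}" f])
  show "continuous_on {0..} f"
    using f by (simp add: admissible_nonlinearity_def)
qed (use assms continuous_on_subset[OF cont_y] in auto)

lemma delay_integral_le:
  assumes "0 \<le> t" "\<And>s. s \<in> {h t..t} \<Longrightarrow> 0 \<le> y s \<and> y s \<le> c"
  shows "I t \<le> f c"
proof (rule delay_integral_bounds(2)[OF R assms(1) h_le[OF assms(1)] f_y_continuous])
  fix s assume "s \<in> {h t..t}"
  with assms(2)[OF this] show "0 \<le> f (y s) \<and> f (y s) \<le> f c"
    by (simp add: admissible_nonlinearity_nonneg[OF f] admissible_nonlinearity_le_iff[OF f])
qed (use assms in auto)

lemma delay_integral_ge:
  assumes "0 \<le> t" "0 \<le> c" "\<And>s. s \<in> {h t..t} \<Longrightarrow> c \<le> y s"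
  shows "f c \<le> I t"
proof -
  have nonneg: "0 \<le> y s" if "s \<in> {h t..t}" for s
    using assms(2) assms(3)[OF that] by simp
  have cont: "continuous_on {h t..t} (\<lambda>s. f (y s))"
    using nonneg by (rule f_y_continuous)
  \<comment> \<open>\<open>delay_integral_bounds\<close> asks for bounds on both sides; the missing
    upper one is the maximum over the compact delay window.\<close>
  then obtain m where m: "\<forall>s\<in>{h t..t}. f (y s) \<le> f (y m)"
    using continuous_attains_sup[OF compact_Icc _ cont] h_le[OF assms(1)] by fastforce
  show ?thesis
  proof (rule delay_integral_bounds(1)[OF R assms(1) h_le[OF assms(1)] cont])
    fix s assume s: "s \<in> {h t..t}"
    show "f c \<le> f (y s) \<and> f (y s) \<le> f (y m)"
      using m assms(2) assms(3)[OF s] s by (simp add: admissible_nonlinearity_le_iff[OF f])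
  qed
qed

text \<open>Replaces the delay equation by an inequality without delay, to which the scalar lemmas
  apply.\<close>

lemma AE_derivative_le:
  assumes "\<And>t. t \<in> A \<Longrightarrow> 0 \<le> t"
    and "\<And>t s. t \<in> A \<Longrightarrow> s \<in> {h t..t} \<Longrightarrow> 0 \<le> y s \<and> y s \<le> c"
  shows "AE t in lebesgue. t \<in> A \<longrightarrow> (\<exists>D. (x has_real_derivative D) (at t) \<and> D \<le> r t * (f c - x t))"
  using deriv
proof eventually_elim
  case (elim t)
  have "r t * (I t - x t) \<le> r t * (f c - x t)" if "t \<in> A"
    using delay_integral_le[of t c] assms[OF that] r_nonneg[of t] by (intro mult_left_mono) auto
  then show ?case
    using elim assms(1) by blast
qed

text \<open>Lower bounds on \<open>x\<close> are obtained as upper bounds on \<open>- x\<close>; the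
  form of the right-hand side matches the scalar lemmas with \<open>L = - f c\<close>.\<close>

lemma AE_minus_derivative_le:
  assumes "\<And>t. t \<in> A \<Longrightarrow> 0 \<le> t" and "0 \<le> c"
    and "\<And>t s. t \<in> A \<Longrightarrow> s \<in> {h t..t} \<Longrightarrow> c \<le> y s"
  shows "AE t in lebesgue. t \<in> A \<longrightarrow>
    (\<exists>D. ((\<lambda>t. - x t) has_real_derivative D) (at t) \<and> D \<le> r t * (- f c - - x t))"
  using deriv
proof eventually_elim
  case (elim t)
  show ?case
  proof
    assume "t \<in> A"
    then have "f c \<le> I t" "0 \<le> t"
      using delay_integral_ge[of t c] assms by auto
    then have "- (r t * (I t - x t)) \<le> r t * (- f c - - x t)"
      using mult_left_mono[of "f c" "I t" "r t"] r_nonneg[of t] by (simp add: algebra_simps)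
    then show "\<exists>D. ((\<lambda>t. - x t) has_real_derivative D) (at t) \<and> D \<le> r t * (- f c - - x t)"
      using DERIV_minus elim \<open>0 \<le> t\<close> by blast
  qed
qed

lemma upper_barrier:
  assumes "0 \<le> a" "a \<le> b"
    and "\<And>t s. t \<in> {a<..<b} \<Longrightarrow> s \<in> {h t..t} \<Longrightarrow> 0 \<le> y s \<and> y s \<le> c"
  shows "x b \<le> max (x a) (f c)"
proof (rule abs_cont_upper_barrier[OF assms(2) loc_abs_cont_nonneg_imp_Icc[OF ac assms(1)]])
  show "0 \<le> r t" if "a \<le> t" for t
    using that assms(1) by (intro r_nonneg) simp
qed (use assms in \<open>intro AE_derivative_le, auto\<close>)

lemma lower_barrier:
  assumes "0 \<le> a" "a \<le> b" "0 \<le> c"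
    and "\<And>t s. t \<in> {a<..<b} \<Longrightarrow> s \<in> {h t..t} \<Longrightarrow> c \<le> y s"
  shows "min (x a) (f c) \<le> x b"
proof -
  have "- x b \<le> max (- x a) (- f c)"
  proof (rule abs_cont_upper_barrier[OF assms(2)])
    show "abs_cont_on_Icc a b (\<lambda>t. - x t)"
      by (intro abs_cont_on_Icc_minus loc_abs_cont_nonneg_imp_Icc ac assms(1))
    show "0 \<le> r t" if "a \<le> t" for t
      using that assms(1) by (intro r_nonneg) simp
  qed (use assms in \<open>intro AE_minus_derivative_le, auto\<close>)
  then show ?thesis
    by linarith
qed

text \<open>Since \<open>h t\<close> tends to infinity, the whole delay window eventually lies where
  \<open>P\<close> holds.\<close>

lemma eventually_delayed:
  assumes "\<forall>\<^sub>F t in at_top. P t"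
  obtains a where "0 \<le> a" "\<And>t s. a < t \<Longrightarrow> s \<in> {h t..t} \<Longrightarrow> P s"
proof -
  obtain T where T: "\<And>t. T \<le> t \<Longrightarrow> P t"
    using assms unfolding eventually_at_top_linorder by blast
  have "\<forall>\<^sub>F t in at_top. T \<le> h t"
    using h by (simp add: admissible_delay_def filterlim_at_top)
  then obtain a where a: "\<And>t. a \<le> t \<Longrightarrow> T \<le> h t"
    unfolding eventually_at_top_linorder by blast
  show ?thesis
  proof (rule that[of "max 0 a"])
    show "P s" if "max 0 a < t" "s \<in> {h t..t}" for t s
      using T[of s] a[of t] that by simp
  qed simp
qed

lemma eventually_le:
  assumes "\<And>t. 0 \<le> y t" "\<forall>\<^sub>F t in at_top. y t \<le> c" "f c < L"
  shows "\<forall>\<^sub>F t in at_top. x t \<le> L"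
proof -
  obtain a where a: "0 \<le> a" "\<And>t s. a < t \<Longrightarrow> s \<in> {h t..t} \<Longrightarrow> y s \<le> c"
    using eventually_delayed[OF assms(2)] by blast
  show ?thesis
  proof (rule abs_cont_eventually_le[OF a(1) _ r _ assms(3)])
    show "abs_cont_on_Icc c d x" if "a \<le> c" for c d
      using that a(1) by (intro loc_abs_cont_nonneg_imp_Icc ac) simp
  qed (use a assms(1) in \<open>intro AE_derivative_le, auto\<close>)
qed

lemma eventually_ge:
  assumes "0 \<le> c" "\<forall>\<^sub>F t in at_top. c \<le> y t" "L < f c"
  shows "\<forall>\<^sub>F t in at_top. L \<le> x t"
proof -
  obtain a where a: "0 \<le> a" "\<And>t s. a < t \<Longrightarrow> s \<in> {h t..t} \<Longrightarrow> c \<le> y s"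
    using eventually_delayed[OF assms(2)] by blast
  have "\<forall>\<^sub>F t in at_top. - x t \<le> - L"
  proof (rule abs_cont_eventually_le[OF a(1) _ r])
    show "abs_cont_on_Icc c d (\<lambda>t. - x t)" if "a \<le> c" for c d
      using that a(1) by (intro abs_cont_on_Icc_minus loc_abs_cont_nonneg_imp_Icc ac) simp
    show "- f c < - L"
      using assms(3) by simp
  qed (use a assms(1) in \<open>intro AE_minus_derivative_le, auto\<close>)
  then show ?thesis
    by simp
qed

text \<open>A nonnegative input makes the integral term nonnegative, so \<open>x\<close> decays no
  faster than exponentially and cannot reach 0 at time \<open>t\<close>.\<close>

lemma positive_step:
  assumes "0 < t" and y: "\<And>s. s < t \<Longrightarrow> 0 \<le> y s" and x: "\<And>s. s \<in> {0..<t} \<Longrightarrow> 0 < x s"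
  shows "0 < x t"
proof -
  obtain C where "AE s in lebesgue_on {0..}. \<bar>r s\<bar> \<le> C"
    using r by (auto simp: admissible_rate_def)
  then have C: "AE s in lebesgue. s \<in> {0..} \<longrightarrow> \<bar>r s\<bar> \<le> C"
    by (subst (asm) AE_restrict_space_iff) auto
  show ?thesis
  proof (rule abs_cont_positive[OF \<open>0 < t\<close> loc_abs_cont_nonneg_imp_Icc[OF ac order.refl] x])
    \<comment> \<open>The constant must be strictly positive, which the essential bound
      \<open>C\<close> itself need not be.\<close>
    show "0 < \<bar>C\<bar> + 1"
      by simp
    show "AE s in lebesgue. s \<in> {0<..<t} \<longrightarrow>
        (\<exists>D. (x has_real_derivative D) (at s) \<and> D \<ge> - (\<bar>C\<bar> + 1) * x s)"
      using deriv C
    proof eventually_elim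
      case (elim s)
      show ?case
      proof
        assume s: "s \<in> {0<..<t}"
        have "f 0 \<le> I s"
          using s y by (intro delay_integral_ge) auto
        then have "0 \<le> I s"
          using admissible_nonlinearity_nonneg[OF f, of 0] by simp
        then have "0 \<le> r s * I s"
          using r_nonneg[of s] s by simp
        moreover have "r s * x s \<le> (\<bar>C\<bar> + 1) * x s"
          using elim(2) s x[of s] by (intro mult_right_mono) auto
        ultimately have "- (\<bar>C\<bar> + 1) * x s \<le> r s * (I s - x s)"
          by (simp add: algebra_simps)
        then show "\<exists>D. (x has_real_derivative D) (at s) \<and> D \<ge> - (\<bar>C\<bar> + 1) * x s"
          using elim(1) s by (meson greaterThanLessThan_iff order.strict_implies_order)
      qed
    qed
  qed
qed

end

subsection \<open>The coupled system\<close>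

locale delay_system =
  eq1: delay_component f1 h1 r1 x y R1 + eq2: delay_component f2 h2 r2 y x R2
  for f1 h1 r1 f2 h2 r2 x y :: "real \<Rightarrow> real" and R1 R2 :: "real \<Rightarrow> real \<Rightarrow> real" +
  assumes history_nonneg: "t < 0 \<Longrightarrow> 0 \<le> x t \<and> 0 \<le> y t"
    and initial_pos: "0 < x 0" "0 < y 0"
    and history_bounded: "\<exists>K. \<forall>t\<le>0. x t \<le> K \<and> y t \<le> K"
begin

text \<open>By this symmetry the limits need to be established for \<open>x\<close> only.\<close>

lemma swapped: "delay_system f2 h2 r2 f1 h1 r1 y x R2 R1"
  using history_nonneg initial_pos history_bounded
  by (intro delay_system.intro delay_system_axioms.intro eq1.delay_component_axioms eq2.delay_component_axioms) auto

text \<open>Positivity of this minimum says that the pair lies in the open quadrant above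
  \<open>(a, b)\<close>, which makes the first exit argument scalar.\<close>

lemma min_continuous: "continuous_on S (\<lambda>t. min (x t - a) (y t - b))"
  by (intro continuous_intros continuous_on_subset[OF eq1.cont_y] continuous_on_subset[OF eq2.cont_y]) auto

lemma positive:
  assumes "0 \<le> t"
  shows "0 < x t" "0 < y t"
proof -
  have "0 < min (x t - 0) (y t - 0)"
  proof (rule positive_by_first_zero[OF min_continuous _ _ assms])
    fix t :: real assume t: "0 < t" and pos: "\<And>s. s \<in> {0..<t} \<Longrightarrow> 0 < min (x s - 0) (y s - 0)"
    have "0 < x s \<and> 0 < y s" if "s \<in> {0..<t}" for s
      using pos[OF that] by simp
    moreover from this have "0 \<le> x s \<and> 0 \<le> y s" if "s < t" for s
      using that history_nonneg[of s] by (cases "s < 0") (auto simp: less_imp_le)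
    ultimately show "0 < min (x t - 0) (y t - 0)"
      using eq1.positive_step[OF t] eq2.positive_step[OF t] by simp
  qed (use initial_pos in auto)
  then show "0 < x t" "0 < y t"
    by auto
qed

lemma nonneg: "0 \<le> x t" "0 \<le> y t"
  using positive[of t] history_nonneg[of t] by (cases "t < 0"; simp)+

text \<open>Transfers the hypothesis to the swapped system: if \<open>f2 (f1 w)\<close> were at
  least \<open>w\<close>, applying \<open>f1\<close> would contradict the hypothesis at
  \<open>z = f1 w\<close>.\<close>

lemma composition_less_swap:
  assumes "\<And>z. 0 < z \<Longrightarrow> f1 (f2 z) < z" and "0 < w"
  shows "f2 (f1 w) < w"
proof (rule ccontr)
  note pos = admissible_nonlinearity_pos[OF eq1.f \<open>0 < w\<close>]
  assume "\<not> f2 (f1 w) < w"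
  then have "f1 w \<le> f1 (f2 (f1 w))"
    using \<open>0 < w\<close> admissible_nonlinearity_pos[OF eq2.f pos] by (subst admissible_nonlinearity_le_iff[OF eq1.f]) auto
  then show False
    using assms(1)[OF pos] by simp
qed

lemma composition_greater_swap:
  assumes "\<And>z. 0 < z \<Longrightarrow> z < f1 (f2 z)" and "0 < w"
  shows "w < f2 (f1 w)"
proof (rule ccontr)
  note pos = admissible_nonlinearity_pos[OF eq1.f \<open>0 < w\<close>]
  assume "\<not> w < f2 (f1 w)"
  then have "f1 (f2 (f1 w)) \<le> f1 w"
    using \<open>0 < w\<close> admissible_nonlinearity_pos[OF eq2.f pos] by (subst admissible_nonlinearity_le_iff[OF eq1.f]) auto
  then show False
    using assms(1)[OF pos] by simp
qed

text \<open>The rectangle \<open>x < A\<close>, \<open>y < B\<close> contains the history and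
  satisfies \<open>f1 B < A\<close> and \<open>f2 A < B\<close>, so the barriers exclude a first
  exit.\<close>

lemma eventually_bounded:
  assumes contr: "\<And>z. 0 < z \<Longrightarrow> f1 (f2 z) < z"
  shows "\<exists>A. \<forall>\<^sub>F t in at_top. x t \<le> A"
proof -
  obtain K where K: "\<And>t. t \<le> 0 \<Longrightarrow> x t \<le> K \<and> y t \<le> K"
    using history_bounded by blast
  have "0 < K"
    using K[of 0] initial_pos by simp
  \<comment> \<open>\<open>A\<close> exceeds both \<open>K\<close> and \<open>f1 K\<close>, so
    \<open>f1 m < A\<close> holds whichever term attains the maximum \<open>m\<close> of
    \<open>K\<close> and \<open>f2 A\<close>; for \<open>f2 A\<close> this is \<open>contr\<close>.
    Right continuity then allows \<open>B\<close> strictly above \<open>m\<close>.\<close>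
  define A where "A = max K (f1 K) + 1"
  have A: "K < A" "f1 K < A" "0 < A"
    using \<open>0 < K\<close> by (auto simp: A_def)
  define m where "m = max K (f2 A)"
  have "f1 m < A"
    using A contr[OF A(3)] by (auto simp: m_def max_def)
  moreover have "0 \<le> m"
    using \<open>0 < K\<close> by (simp add: m_def)
  ultimately obtain B where B: "m < B" "f1 B < A"
    using admissible_nonlinearity_less_right[OF eq1.f] by blast
  have rect: "0 < min (A - x t) (B - y t)" if "0 \<le> t" for t
  proof (rule positive_by_first_zero[OF _ _ _ that])
    show "continuous_on {0..} (\<lambda>t. min (A - x t) (B - y t))"
      by (intro continuous_intros continuous_on_subset[OF eq1.cont_y] continuous_on_subset[OF eq2.cont_y]) auto
    show "0 < min (A - x 0) (B - y 0)"
      using K[of 0] A B(1) by (auto simp: m_def)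
    fix t :: real assume t: "0 < t" and inside: "\<And>s. s \<in> {0..<t} \<Longrightarrow> 0 < min (A - x s) (B - y s)"
    have "x s \<le> A \<and> y s \<le> B" if "s < t" for s
    proof (cases "0 \<le> s")
      case True
      then show ?thesis
        using inside[of s] that by simp
    next
      case False
      then show ?thesis
        using K[of s] A(1) B(1) by (simp add: m_def)
    qed
    then have "x t \<le> max (x 0) (f1 B)" "y t \<le> max (y 0) (f2 A)"
      using t nonneg by (intro eq1.upper_barrier eq2.upper_barrier; simp)+
    then show "0 < min (A - x t) (B - y t)"
      using K[of 0] A(1) B by (auto simp: m_def)
  qed
  have "x t \<le> A" if "0 \<le> t" for t
    using rect[OF that] by simp
  then show ?thesis
    unfolding eventually_at_top_linorder by blast
qed

lemma tendsto_zero: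
  assumes contr: "\<And>z. 0 < z \<Longrightarrow> f1 (f2 z) < z"
  shows "(x \<longlongrightarrow> 0) at_top"
proof -
  define S where "S = {c. \<forall>\<^sub>F t in at_top. x t \<le> c}"
  have "S \<noteq> {}"
    using eventually_bounded[OF contr] by (auto simp: S_def)
  have "0 \<le> c" if "c \<in> S" for c
  proof -
    have "\<forall>\<^sub>F t in at_top. x t \<le> c"
      using that by (simp add: S_def)
    then obtain t where "x t \<le> c"
      unfolding eventually_at_top_linorder by blast
    then show ?thesis
      using nonneg(1)[of t] by simp
  qed
  then have bdd: "bdd_below S" and "0 \<le> Inf S"
    using \<open>S \<noteq> {}\<close> by (auto intro: bdd_belowI[of _ 0] cInf_greatest)
  \<comment> \<open>The infimum itself need not be an eventual bound, but every larger number
    is.\<close>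
  have le: "\<forall>\<^sub>F t in at_top. x t \<le> c" if less: "Inf S < c" for c
  proof -
    obtain c' where "c' \<in> S" "c' < c"
      using cInf_lessD[OF \<open>S \<noteq> {}\<close> less] by blast
    then show ?thesis
      unfolding S_def by (auto elim: eventually_mono)
  qed
  have "Inf S = 0"
  proof (rule ccontr)
    assume "Inf S \<noteq> 0"
    then have "0 < Inf S"
      using \<open>0 \<le> Inf S\<close> by simp
    have f2_nonneg: "0 \<le> f2 (Inf S)"
      by (rule admissible_nonlinearity_nonneg[OF eq2.f \<open>0 \<le> Inf S\<close>])
    \<comment> \<open>The numbers are chosen backwards through the loop: the eventual bound
      \<open>c\<close> on \<open>x\<close> gives \<open>d\<close> on \<open>y\<close>, which gives
      some \<open>e\<close> below \<open>Inf S\<close> on \<open>x\<close>, a contradiction.\<close>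
    obtain d where d: "f2 (Inf S) < d" "f1 d < Inf S"
      using admissible_nonlinearity_less_right[OF eq1.f f2_nonneg contr[OF \<open>0 < Inf S\<close>]] .
    obtain c where c: "Inf S < c" "f2 c < d"
      using admissible_nonlinearity_less_right[OF eq2.f \<open>0 \<le> Inf S\<close> d(1)] .
    have y_le: "\<forall>\<^sub>F t in at_top. y t \<le> d"
      by (rule eq2.eventually_le[OF nonneg(1) le[OF c(1)] c(2)])
    obtain e where e: "f1 d < e" "e < Inf S"
      using dense[OF d(2)] by blast
    have "\<forall>\<^sub>F t in at_top. x t \<le> e"
      by (rule eq1.eventually_le[OF nonneg(2) y_le e(1)])
    then have "Inf S \<le> e"
      using bdd by (intro cInf_lower) (simp_all add: S_def)
    then show False
      using e(2) by simp
  qed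
  show ?thesis
  proof (rule order_tendstoI)
    fix c :: real assume "c < 0"
    then show "\<forall>\<^sub>F t in at_top. c < x t"
      using nonneg(1) less_le_trans by (intro always_eventually) blast
  next
    fix c :: real assume "0 < c"
    then have "\<forall>\<^sub>F t in at_top. x t \<le> c / 2"
      using \<open>Inf S = 0\<close> by (intro le) simp
    then show "\<forall>\<^sub>F t in at_top. x t < c"
      by eventually_elim (use \<open>0 < c\<close> in simp)
  qed
qed

text \<open>The history may vanish before time 0, so the invariant quadrant is entered only at a
  time \<open>T\<close> after which all delay windows lie in \<open>{0..}\<close>. On
  \<open>{0..T}\<close> both components have positive minima.\<close>

lemma eventually_bounded_below:
  assumes expand: "\<And>z. 0 < z \<Longrightarrow> z < f1 (f2 z)"
  shows "\<exists>a>0. \<forall>\<^sub>F t in at_top. a \<le> x t"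
proof -
  obtain T1 where T1: "0 \<le> T1" "\<And>t s. T1 < t \<Longrightarrow> s \<in> {h1 t..t} \<Longrightarrow> 0 \<le> s"
    using eq1.eventually_delayed[OF eventually_ge_at_top, of 0] by blast
  obtain T2 where T2: "0 \<le> T2" "\<And>t s. T2 < t \<Longrightarrow> s \<in> {h2 t..t} \<Longrightarrow> 0 \<le> s"
    using eq2.eventually_delayed[OF eventually_ge_at_top, of 0] by blast
  define T where "T = max T1 T2"
  have T: "0 \<le> T"
    using T1 by (simp add: T_def)
  obtain tx where tx: "tx \<in> {0..T}" "\<And>t. t \<in> {0..T} \<Longrightarrow> x tx \<le> x t"
    using continuous_attains_inf[OF compact_Icc _ continuous_on_subset[OF eq2.cont_y subset_UNIV], of 0 T] T by auto
  obtain ty where ty: "ty \<in> {0..T}" "\<And>t. t \<in> {0..T} \<Longrightarrow> y ty \<le> y t"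
    using continuous_attains_inf[OF compact_Icc _ continuous_on_subset[OF eq1.cont_y subset_UNIV], of 0 T] T by auto
  have pos: "0 < x tx" "0 < y ty"
    using tx(1) ty(1) by (auto intro: positive)
  \<comment> \<open>Halving puts \<open>a\<close> strictly below both terms. Then
    \<open>a < f1 n\<close> holds whether \<open>n\<close> is \<open>y ty\<close> or
    \<open>f2 a\<close>, by \<open>expand\<close> in the latter case, and left continuity allows
    \<open>b\<close> strictly below \<open>n\<close>.\<close>
  define a where "a = min (x tx) (f1 (y ty)) / 2"
  have a: "0 < a" "a < x tx" "a < f1 (y ty)"
    using pos admissible_nonlinearity_pos[OF eq1.f pos(2)] by (auto simp: a_def min_def)
  define n where "n = min (y ty) (f2 a)"
  have n: "0 < n" "a < f1 n"
    using pos a expand[OF a(1)] admissible_nonlinearity_pos[OF eq2.f a(1)] by (auto simp: n_def min_def)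
  obtain b where b: "0 \<le> b" "b < n" "a < f1 b"
    using admissible_nonlinearity_greater_left[OF eq1.f n] .
  have start: "0 < min (x t - a) (y t - b)" if "t \<in> {0..T}" for t
    using tx(2)[OF that] ty(2)[OF that] a(2) b(2) by (auto simp: n_def)
  have rect: "0 < min (x t - a) (y t - b)" if "T \<le> t" for t
  proof (rule positive_by_first_zero[OF min_continuous _ _ that])
    show "0 < min (x T - a) (y T - b)"
      using start[of T] T by simp
    fix t :: real assume t: "T < t" and inside: "\<And>s. s \<in> {T..<t} \<Longrightarrow> 0 < min (x s - a) (y s - b)"
    \<comment> \<open>A delay window may reach back before \<open>T\<close>; its points there are
      covered by \<open>start\<close>.\<close>
    have inside': "a \<le> x s" "b \<le> y s" if "0 \<le> s" "s < t" for s
      using inside[of s] start[of s] that by (cases "s < T"; simp)+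
    have "min (x T) (f1 b) \<le> x t"
    proof (rule eq1.lower_barrier[OF T _ b(1)])
      show "b \<le> y s" if "u \<in> {T<..<t}" "s \<in> {h1 u..u}" for u s
        using that T1(2)[of u s] by (intro inside') (auto simp: T_def)
    qed (use t in simp)
    moreover have "min (y T) (f2 a) \<le> y t"
    proof (rule eq2.lower_barrier[OF T])
      show "a \<le> x s" if "u \<in> {T<..<t}" "s \<in> {h2 u..u}" for u s
        using that T2(2)[of u s] by (intro inside') (auto simp: T_def)
    qed (use t a(1) in simp_all)
    ultimately show "0 < min (x t - a) (y t - b)"
      using start[of T] T b(2,3) by (auto simp: n_def)
  qed
  have "a \<le> x t" if "T \<le> t" for t
    using rect[OF that] by simp
  then show ?thesis
    using a(1) unfolding eventually_at_top_linorder by blast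
qed

lemma divergent:
  assumes expand: "\<And>z. 0 < z \<Longrightarrow> z < f1 (f2 z)"
  shows "filterlim x at_top at_top"
proof (rule ccontr)
  assume "\<not> filterlim x at_top at_top"
  then obtain Z where Z: "\<not> (\<forall>\<^sub>F t in at_top. Z \<le> x t)"
    by (auto simp: filterlim_at_top)
  define S where "S = {c. \<forall>\<^sub>F t in at_top. c \<le> x t}"
  obtain a where a: "0 < a" "a \<in> S"
    using eventually_bounded_below[OF expand] by (auto simp: S_def)
  have "c \<le> Z" if "c \<in> S" for c
  proof (rule ccontr)
    assume "\<not> c \<le> Z"
    have "\<forall>\<^sub>F t in at_top. c \<le> x t"
      using that by (simp add: S_def)
    then have "\<forall>\<^sub>F t in at_top. Z \<le> x t"
      by eventually_elim (use \<open>\<not> c \<le> Z\<close> in simp)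
    then show False
      using Z by simp
  qed
  then have bdd: "bdd_above S"
    by (rule bdd_aboveI)
  have "0 < Sup S"
    using cSup_upper[OF a(2) bdd] a(1) by simp
  have f2_pos: "0 < f2 (Sup S)"
    by (rule admissible_nonlinearity_pos[OF eq2.f \<open>0 < Sup S\<close>])
  \<comment> \<open>Dual to the choice in \<open>tendsto_zero\<close>: the lower bound
    \<open>c\<close> on \<open>x\<close> gives \<open>d\<close> on \<open>y\<close>, which gives
    some \<open>e\<close> above \<open>Sup S\<close> on \<open>x\<close>.\<close>
  obtain d where d: "0 \<le> d" "d < f2 (Sup S)" "Sup S < f1 d"
    using admissible_nonlinearity_greater_left[OF eq1.f f2_pos expand[OF \<open>0 < Sup S\<close>]] .
  obtain c where c: "0 \<le> c" "c < Sup S" "d < f2 c"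
    using admissible_nonlinearity_greater_left[OF eq2.f \<open>0 < Sup S\<close> d(2)] .
  obtain c' where "c' \<in> S" "c < c'"
    using less_cSup_iff[OF _ bdd, of c] a(2) c(2) by blast
  then have x_ge: "\<forall>\<^sub>F t in at_top. c \<le> x t"
    unfolding S_def by (auto elim: eventually_mono)
  have y_ge: "\<forall>\<^sub>F t in at_top. d \<le> y t"
    by (rule eq2.eventually_ge[OF c(1) x_ge c(3)])
  obtain e where e: "Sup S < e" "e < f1 d"
    using dense[OF d(3)] by blast
  have "\<forall>\<^sub>F t in at_top. e \<le> x t"
    by (rule eq1.eventually_ge[OF d(1) y_ge e(2)])
  then have "e \<le> Sup S"
    using bdd by (intro cSup_upper) (simp_all add: S_def)
  then show False
    using e(1) by simp
qed

end

section \<open>From the extended inverse to the composition, and from solutions to the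
  locale\<close>

lemma ext_inv_greater_imp:
  assumes "admissible_nonlinearity f" "0 \<le> w" "ereal w < ext_inv f z"
  shows "f w < z"
proof (rule ccontr)
  assume nless: "\<not> f w < z"
  have f: "continuous_on {0..} f" "strict_mono_on {0..} f"
    using assms(1) by (auto simp: admissible_nonlinearity_def)
  have "f 0 \<le> z"
    using assms(2,3) by (auto simp: ext_inv_def split: if_splits)
  have "continuous_on {0..w} f"
    using f(1) by (rule continuous_on_subset) auto
  \<comment> \<open>By the intermediate value theorem \<open>z\<close> is attained on
    \<open>{0..w}\<close>, so the extended inverse is finite and at most \<open>w\<close>.\<close>
  then obtain v where v: "0 \<le> v" "v \<le> w" "f v = z"
    using IVT'[of f 0 z w] \<open>f 0 \<le> z\<close> nless \<open>0 \<le> w\<close> by auto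
  then have "the_inv_into {0..} f z = v"
    using the_inv_into_f_f[OF strict_mono_on_imp_inj_on[OF f(2)], of v] by simp
  then show False
    using assms(3) v \<open>f 0 \<le> z\<close> by (auto simp: ext_inv_def split: if_splits)
qed

text \<open>The hypothesis rules out the value infinity, so \<open>z\<close> is either below
  \<open>f 0\<close> or attained at some point less than \<open>w\<close>.\<close>

lemma ext_inv_less_imp:
  assumes "admissible_nonlinearity f" "0 \<le> w" "ext_inv f z < ereal w"
  shows "z < f w"
proof (cases "z < f 0")
  case True
  then show ?thesis
    using admissible_nonlinearity_le_iff[OF assms(1), of 0 w] assms(2) by simp
next
  case False
  have inj: "inj_on f {0..}"
    using assms(1) by (auto simp: admissible_nonlinearity_def intro: strict_mono_on_imp_inj_on)
  obtain v where v: "0 \<le> v" "f v = z"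
    using False assms(3) by (auto simp: ext_inv_def split: if_splits)
  then have "the_inv_into {0..} f z = v"
    using the_inv_into_f_f[OF inj, of v] by simp
  then have "v < w"
    using False assms(3) v by (auto simp: ext_inv_def split: if_splits)
  then show ?thesis
    using admissible_nonlinearity_le_iff[OF assms(1,2) v(1)] v(2) by (simp add: not_le[symmetric])
qed

text \<open>History and solution agree at 0, so they paste to a function continuous on the whole
  line; this is needed because delay windows may straddle 0.\<close>

lemma solution_continuous:
  assumes ac: "loc_abs_cont_nonneg x" and hist: "admissible_history \<phi>" "\<And>t. t \<le> 0 \<Longrightarrow> x t = \<phi> t"
  shows "continuous_on UNIV x"
proof -
  have "continuous_on {..0} x"
    using hist continuous_on_cong[of "{..0}" "{..0}" x \<phi>] by (simp add: admissible_history_def)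
  moreover have "continuous_on {0..T} x" for T
    by (rule abs_cont_on_Icc_imp_continuous_on[OF loc_abs_cont_nonneg_imp_Icc[OF ac order.refl]])
  ultimately have union: "continuous_on ({..0} \<union> {0..T}) x" for T
    by (intro continuous_on_closed_Un) auto
  have "continuous_on {..<T} x" for T
    by (rule continuous_on_subset[OF union[of T]]) auto
  then have "isCont x t" for t
    using continuous_on_eq_continuous_at[of "{..<t + 1}" x] by auto
  then show ?thesis
    by (simp add: continuous_at_imp_continuous_on)
qed

lemma is_solution_imp_delay_system:
  assumes "admissible_nonlinearity f1" "admissible_nonlinearity f2"
    and "admissible_delay h1" "admissible_delay h2"
    and "admissible_kernel h1 R1" "admissible_kernel h2 R2"
    and "admissible_rate r1" "admissible_rate r2"
    and \<phi>: "admissible_history \<phi>" and \<psi>: "admissible_history \<psi>"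
    and sol: "is_solution f1 f2 h1 h2 R1 R2 r1 r2 \<phi> \<psi> x y"
  shows "delay_system f1 h1 r1 f2 h2 r2 x y R1 R2"
proof -
  have hist: "x t = \<phi> t" "y t = \<psi> t" if "t \<le> 0" for t
    using sol that by (auto simp: is_solution_def)
  have ac: "loc_abs_cont_nonneg x" "loc_abs_cont_nonneg y"
    using sol by (auto simp: is_solution_def)
  have cont: "continuous_on UNIV x" "continuous_on UNIV y"
    by (rule solution_continuous[OF ac(1) \<phi> hist(1)] solution_continuous[OF ac(2) \<psi> hist(2)]; assumption)+
  have ae: "AE t in lebesgue. t \<ge> 0 \<longrightarrow>
        (x has_real_derivative r1 t * (delay_integral h1 R1 (\<lambda>s. f1 (y s)) t - x t)) (at t) \<and>
        (y has_real_derivative r2 t * (delay_integral h2 R2 (\<lambda>s. f2 (x s)) t - y t)) (at t)"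
    using sol by (simp add: is_solution_def)
  have "bounded (\<phi> ` {..0})" "bounded (\<psi> ` {..0})"
    using \<phi> \<psi> by (auto simp: admissible_history_def)
  then obtain K L where K: "\<And>t. t \<le> 0 \<Longrightarrow> \<bar>\<phi> t\<bar> \<le> K" and L: "\<And>t. t \<le> 0 \<Longrightarrow> \<bar>\<psi> t\<bar> \<le> L"
    by (auto simp: bounded_iff)
  have "x t \<le> max K L \<and> y t \<le> max K L" if "t \<le> 0" for t
    using K[OF that] L[OF that] hist[OF that] by auto
  then have bdd: "\<exists>K. \<forall>t\<le>0. x t \<le> K \<and> y t \<le> K"
    by blast
  show ?thesis
  proof (intro delay_system.intro delay_component.intro delay_system_axioms.intro assms ac cont bdd)
    show "AE t in lebesgue. t \<ge> 0 \<longrightarrow>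
        (x has_real_derivative r1 t * (delay_integral h1 R1 (\<lambda>s. f1 (y s)) t - x t)) (at t)"
      using ae by eventually_elim blast
    show "AE t in lebesgue. t \<ge> 0 \<longrightarrow>
        (y has_real_derivative r2 t * (delay_integral h2 R2 (\<lambda>s. f2 (x s)) t - y t)) (at t)"
      using ae by eventually_elim blast
    show "0 < x 0" "0 < y 0"
      using \<phi> \<psi> hist by (simp_all add: admissible_history_def)
    show "0 \<le> x t \<and> 0 \<le> y t" if "t < 0" for t
      using \<phi> \<psi> hist[of t] that by (simp add: admissible_history_def)
  qed
qed

theorem theorem3p5:
  fixes f1 f2 h1 h2 r1 r2 \<phi> \<psi> :: "real \<Rightarrow> real"
    and R1 R2 :: "real \<Rightarrow> real \<Rightarrow> real"
  assumes "admissible_nonlinearity f1" and "admissible_nonlinearity f2"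
    and "admissible_delay h1" and "admissible_delay h2"
    and "admissible_kernel h1 R1" and "admissible_kernel h2 R2"
    and "admissible_rate r1" and "admissible_rate r2"
    and "admissible_history \<phi>" and "admissible_history \<psi>"
  shows "((\<forall>z>0. ereal (f2 z) < ext_inv f1 z) \<longrightarrow>
            (\<forall>x y. is_solution f1 f2 h1 h2 R1 R2 r1 r2 \<phi> \<psi> x y \<longrightarrow>
               (x \<longlongrightarrow> 0) at_top \<and> (y \<longlongrightarrow> 0) at_top)) \<and>
         ((\<forall>z>0. ereal (f2 z) > ext_inv f1 z) \<longrightarrow>
            (\<forall>x y. is_solution f1 f2 h1 h2 R1 R2 r1 r2 \<phi> \<psi> x y \<longrightarrow>
               filterlim x at_top at_top \<and> filterlim y at_top at_top))"
proof (rule conjI; intro impI allI)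
  fix x y
  assume small: "\<forall>z>0. ereal (f2 z) < ext_inv f1 z"
    and sol: "is_solution f1 f2 h1 h2 R1 R2 r1 r2 \<phi> \<psi> x y"
  interpret delay_system f1 h1 r1 f2 h2 r2 x y R1 R2
    by (rule is_solution_imp_delay_system[OF assms sol])
  have contr: "f1 (f2 z) < z" if "0 < z" for z
    using small that admissible_nonlinearity_nonneg[OF assms(2), of z]
    by (intro ext_inv_greater_imp[OF assms(1)]) auto
  show "(x \<longlongrightarrow> 0) at_top \<and> (y \<longlongrightarrow> 0) at_top"
    \<comment> \<open>The limit of \<open>y\<close> is that of the first component of the swapped
      system.\<close>
    using tendsto_zero[OF contr] delay_system.tendsto_zero[OF swapped composition_less_swap[OF contr]] by simp
next
  fix x y
  assume large: "\<forall>z>0. ereal (f2 z) > ext_inv f1 z"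
    and sol: "is_solution f1 f2 h1 h2 R1 R2 r1 r2 \<phi> \<psi> x y"
  interpret delay_system f1 h1 r1 f2 h2 r2 x y R1 R2
    by (rule is_solution_imp_delay_system[OF assms sol])
  have expand: "z < f1 (f2 z)" if "0 < z" for z
    using large that admissible_nonlinearity_nonneg[OF assms(2), of z]
    by (intro ext_inv_less_imp[OF assms(1)]) auto
  show "filterlim x at_top at_top \<and> filterlim y at_top at_top"
    using divergent[OF expand] delay_system.divergent[OF swapped composition_greater_swap[OF expand]] by simp
qed

end
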